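(* Let $\bar{\mathcal X}=\{\mathcal X^1,\dots,\mathcal X^d\}\in\overline{\mathcal M}_{\mathbf r}$ and $\mathcal X=\phi(\bar{\mathcal X})\in\mathcal M_{\mathbf r}$. Let $F$ be a smooth map from $\mathcal M_{\mathbf r}$ to a Euclidean space and let $\bar F=F\circ\phi:\overline{\mathcal M}_{\mathbf r}\to$ that Euclidean space. Let $\bar\xi_{\bar{\mathcal X}}\in\mathcal H_{\bar{\mathcal X}}$ be the (unique) solution of the quotient Gauss--Newton equation $$\langle \mathrm D\bar F(\bar{\mathcal X})[\bar\eta],\bar F(\bar{\mathcal X})\rangle+\langle \mathrm D\bar F(\bar{\mathcal X})[\bar\eta],\mathrm D\bar F(\bar{\mathcal X})[\bar\xi_{\bar{\mathcal X}}]\rangle=0\quad\text{for all }\bar\eta\in\mathcal H_{\bar{\mathcal X}},$$ and let $\xi\in T_{\mathcal X}\mathcal M_{\mathbf r}$ be the (unique) solution of the embedded Gauss--Newton equation $$\langle \mathrm DF(\mathcal X)[\eta],F(\mathcal X)\rangle+\langle \mathrm DF(\mathcal X)[\eta],\mathrm DF(\mathcal X)[\xi]\rangle=0\quad\text{for all }\eta\in T_{\mathcal X}\mathcal M_{\mathbf r}.$$ Then $$\mathrm D\phi(\bar{\mathcal X})[\bar\xi_{\bar{\mathcal X}}]=\xi .$$ Moreover, $$R^E_{\mathcal X}(\xi)=\phi\big(\bar R^Q_{\bar{\mathcal X}}(\bar\xi_{\bar{\mathcal X}})\big),$$ where, writing $\bar\xi_{\bar{\mathcal X}}=\{\xi^1,\dots,\xi^d\}$,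 $\bar R^Q_{\bar{\mathcal X}}(\bar\xi_{\bar{\mathcal X}})=\{\mathcal X^k+\xi^k\}_{k=1}^d$, and $$R^E_{\mathcal X}(\xi)=\phi\Big(\big(\mathrm D\phi(\bar{\mathcal X})|_{\mathcal H_{\bar{\mathcal X}}}\big)^{-1}(d\cdot\mathcal X+\xi)\Big).$$
   Context: Fix integers $d\ge 2$, $n_1,\dots,n_d\ge1$ and $\mathbf r=(r_0,r_1,\dots,r_d)$ with $r_0=r_d=1$, $r_k\ge1$, $r_{k-1}\le n_kr_k$ and $r_k\le n_kr_{k-1}$ for $k=1,\dots,d$. For $\mathcal Z\in\mathbb R^{a\times b\times c}$, the left unfolding $L(\mathcal Z)\in\mathbb R^{ab\times c}$ and right unfolding $R(\mathcal Z)\in\mathbb R^{a\times bc}$ are $L(\mathcal Z)(i_1+a(i_2-1),i_3)=\mathcal Z(i_1,i_2,i_3)$ and $R(\mathcal Z)(i_1,i_2+b(i_3-1))=\mathcal Z(i_1,i_2,i_3)$. Let $E=\prod_{k=1}^d\mathbb R^{r_{k-1}\times n_k\times r_k}$. The total space $\overline{\mathcal M}_{\mathbf r}\subset E$ is the open set of tuples $\bar{\mathcal X}=\{\mathcal X^1,\dots,\mathcal X^d\}$ with $\operatorname{rank}L(\mathcal X^k)=r_k$ and $\operatorname{rank}R(\mathcal X^k)=r_{k-1}$ for $k=1,\dots,d$; hence $T_{\bar{\mathcal X}}\overline{\mathcal M}_{\mathbf r}=E$. The map $\phi:E\to\mathbb R^{n_1\times\cdots\times n_d}$ is $\phi(\bar{\mathcal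 X})(i_1,\dots,i_d)=\mathcal X^1(i_1)\mathcal X^2(i_2)\cdots\mathcal X^d(i_d)$, where $\mathcal X^k(i_k)\in\mathbb R^{r_{k-1}\times r_k}$ is the slice $\mathcal X^k(:,i_k,:)$. The manifold $\mathcal M_{\mathbf r}=\phi(\overline{\mathcal M}_{\mathbf r})$ is the set of tensors $\mathcal X$ of TT rank $\mathbf r$, i.e. whose $k$-th unfolding (the matrix of size $n_1\cdots n_k\times n_{k+1}\cdots n_d$ with rows indexed by $(i_1,\dots,i_k)$ and columns by $(i_{k+1},\dots,i_d)$) has rank $r_k$ for $k=1,\dots,d-1$; it is a smooth embedded submanifold of $\mathbb R^{n_1\times\cdots\times n_d}$. All inner products $\langle\cdot,\cdot\rangle$ are Euclidean (Frobenius). The mode-$j$ product $\mathcal Z\times_j\mathbf A$ is the contraction of the $j$-th index of $\mathcal Z$ with the column index of $\mathbf A$. The vertical space $\mathcal V_{\bar{\mathcal X}}$ (the tangent space at $\bar{\mathcal X}$ to the fiber $\{\bar{\mathcal Y}\in\overline{\mathcal M}_{\mathbf r}:\phi(\bar{\mathcal Y})=\phi(\bar{\mathcal X})\}$) is $$\mathcal V_{\bar{\mathcal X}}=\{\{\mathcal X^1\times_3\mathbf D_1^{\mathsf T},\,-\mathcal X^2\times_1\mathbf D_1+\mathcal X^2\times_3\mathbf D_2^{\mathsf T},\dots,-\mathcal X^d\times_1\mathbf D_{d-1}\}:\mathbf D_k\in\mathbb R^{r_k\times r_k}\}.$$ The preconditioned metric on $\overline{\mathcal M}_{\mathbf r}$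 is $$\bar g_{\bar{\mathcal X}}(\bar\xi,\bar\eta)=\sum_{k=1}^d\langle\phi(\{\mathcal X^1,\dots,\mathcal X^{k-1},\xi^k,\mathcal X^{k+1},\dots,\mathcal X^d\}),\phi(\{\mathcal X^1,\dots,\mathcal X^{k-1},\eta^k,\mathcal X^{k+1},\dots,\mathcal X^d\})\rangle$$ for $\bar\xi=\{\xi^k\},\bar\eta=\{\eta^k\}\in E$. The horizontal space is $\mathcal H_{\bar{\mathcal X}}=\{\bar\xi\in E:\bar g_{\bar{\mathcal X}}(\bar\xi,\bar\eta)=0\ \forall\bar\eta\in\mathcal V_{\bar{\mathcal X}}\}$. The restriction $\mathrm D\phi(\bar{\mathcal X})|_{\mathcal H_{\bar{\mathcal X}}}:\mathcal H_{\bar{\mathcal X}}\to T_{\mathcal X}\mathcal M_{\mathbf r}$ is bijective, and $\mathcal X\in T_{\mathcal X}\mathcal M_{\mathbf r}$, so $R^E_{\mathcal X}(\xi)$ makes sense. *)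

theory Defs
  imports
    "HOL-Analysis.Analysis"
    "HOL-Analysis.Finite_Function_Topology"
    "Jordan_Normal_Form.DL_Rank"
begin

text \<open>
  The sizes \<open>d\<close>, \<open>n\<^sub>k\<close>, \<open>r\<^sub>k\<close> are variables, so tensors are finitely supported functions whose
  support lies in the relevant index box. The type \<open>'i \<Rightarrow>\<^sub>0 real\<close> is a real normed vector space (with
  the l1 norm, which on the finite-dimensional spaces used here defines the same topology and the
  same derivatives as the Frobenius norm). The modes \<open>k = 1, \<dots>, d\<close> are numbered from 1, the entries
  of a tensor or matrix in each mode from 0.
\<close>

type_synonym core = "nat \<times> nat \<times> nat \<Rightarrow>\<^sub>0 real"
type_synonym cores = "nat \<Rightarrow>\<^sub>0 core"
type_synonym tensor = "nat list \<Rightarrow>\<^sub>0 real"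

abbreviation entry :: "('i \<Rightarrow>\<^sub>0 'a::zero) \<Rightarrow> 'i \<Rightarrow> 'a" where
  "entry \<equiv> Poly_Mapping.lookup"

text \<open>To be used for finite \<open>I\<close> only.\<close>

definition on_support :: "'i set \<Rightarrow> ('i \<Rightarrow> 'a::zero) \<Rightarrow> ('i \<Rightarrow>\<^sub>0 'a)" where
  "on_support I f = Abs_poly_mapping (\<lambda>i. if i \<in> I then f i else 0)"

lemma entry_on_support:
  assumes "finite I"
  shows "entry (on_support I f) i = (if i \<in> I then f i else 0)"
proof -
  have "finite {i. (if i \<in> I then f i else 0) \<noteq> 0}"
    using assms by (rule rev_finite_subset) auto
  then show ?thesis
    unfolding on_support_def by (simp add: Abs_poly_mapping_inverse)
qed

definition frobenius :: "('i \<Rightarrow>\<^sub>0 real) \<Rightarrow> ('i \<Rightarrow>\<^sub>0 real) \<Rightarrow> real" where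
  "frobenius S T = (\<Sum>i\<in>Poly_Mapping.keys S. entry S i * entry T i)"


primrec Ck_on :: "nat \<Rightarrow> ('a::real_normed_vector \<Rightarrow> 'b::real_normed_vector) \<Rightarrow> 'a set \<Rightarrow> bool" where
  "Ck_on 0 f U \<longleftrightarrow> continuous_on U f"
| "Ck_on (Suc k) f U \<longleftrightarrow>
     (\<forall>x\<in>U. f differentiable (at x)) \<and> (\<forall>v. Ck_on k (\<lambda>x. frechet_derivative f (at x) v) U)"

definition smooth_on_open :: "('a::real_normed_vector \<Rightarrow> 'b::real_normed_vector) \<Rightarrow> 'a set \<Rightarrow> bool" where
  "smooth_on_open f U \<longleftrightarrow> open U \<and> (\<forall>k. Ck_on k f U)"

text \<open>
  Smooth maps on an embedded submanifold are those that extend smoothly to a neighbourhood of each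
  point. That \<open>U\<close> is open in the whole type and not only in the finite-dimensional space \<open>V\<close>
  containing \<open>M\<close> makes no difference: compose with the coordinate projection onto \<open>V\<close>.
\<close>

definition smooth_on_submanifold ::
    "('a::real_normed_vector \<Rightarrow> 'b::real_normed_vector) \<Rightarrow> 'a set \<Rightarrow> bool" where
  "smooth_on_submanifold f M \<longleftrightarrow>
     (\<forall>x\<in>M. \<exists>U g. x \<in> U \<and> smooth_on_open g U \<and> (\<forall>y\<in>U \<inter> M. g y = f y))"

definition tangent_space :: "'a::real_normed_vector set \<Rightarrow> 'a \<Rightarrow> 'a set" where
  "tangent_space M x =
     {v. \<exists>\<epsilon>>0. \<exists>c::real \<Rightarrow> 'a. smooth_on_open c {-\<epsilon><..<\<epsilon>} \<and> c ` {-\<epsilon><..<\<epsilon>} \<subseteq> M \<and>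
           c 0 = x \<and> (c has_vector_derivative v) (at 0)}"

text \<open>
  For \<open>f\<close> smooth on \<open>M\<close>, a Frechet derivative of \<open>f\<close> at \<open>x\<close> within \<open>M\<close> exists, but only its values on
  \<open>tangent_space M x\<close> are determined; there they are the differential \<open>Df(x)[v] = (f \<circ> c)'(0)\<close> for
  any curve \<open>c\<close> in \<open>M\<close> with \<open>c(0) = x\<close> and \<open>c'(0) = v\<close>. It is applied to tangent vectors only.
\<close>

definition differential ::
    "'a::real_normed_vector set \<Rightarrow> ('a \<Rightarrow> 'b::real_normed_vector) \<Rightarrow> 'a \<Rightarrow> 'a \<Rightarrow> 'b" where
  "differential M f x = frechet_derivative f (at x within M)"


text \<open>The space \<open>E\<close>; the core \<open>X\<^sup>k\<close> of \<open>X\<close> is \<open>entry X k\<close>.\<close>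

definition core_space :: "nat \<Rightarrow> (nat \<Rightarrow> nat) \<Rightarrow> (nat \<Rightarrow> nat) \<Rightarrow> cores set" where
  "core_space d n r =
     {X. Poly_Mapping.keys X \<subseteq> {1..d} \<and>
         (\<forall>k\<in>{1..d}. Poly_Mapping.keys (entry X k) \<subseteq> {..<r (k - 1)} \<times> {..<n k} \<times> {..<r k})}"

definition left_unfolding :: "nat \<Rightarrow> nat \<Rightarrow> nat \<Rightarrow> core \<Rightarrow> real mat" where
  "left_unfolding a b c Z = mat (a * b) c (\<lambda>(p, i3). entry Z (p mod a, p div a, i3))"

definition right_unfolding :: "nat \<Rightarrow> nat \<Rightarrow> nat \<Rightarrow> core \<Rightarrow> real mat" where
  "right_unfolding a b c Z = mat a (b * c) (\<lambda>(i1, q). entry Z (i1, q mod b, q div b))"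

text \<open>The first argument of \<^const>\<open>vec_space.rank\<close> is the number of rows.\<close>

definition total_space :: "nat \<Rightarrow> (nat \<Rightarrow> nat) \<Rightarrow> (nat \<Rightarrow> nat) \<Rightarrow> cores set" where
  "total_space d n r =
     {X \<in> core_space d n r. \<forall>k\<in>{1..d}.
        vec_space.rank (r (k - 1) * n k) (left_unfolding (r (k - 1)) (n k) (r k) (entry X k)) = r k \<and>
        vec_space.rank (r (k - 1)) (right_unfolding (r (k - 1)) (n k) (r k) (entry X k)) = r (k - 1)}"

definition slice :: "(nat \<Rightarrow> nat) \<Rightarrow> cores \<Rightarrow> nat \<Rightarrow> nat \<Rightarrow> real mat" where
  "slice r X k i = mat (r (k - 1)) (r k) (\<lambda>(a, b). entry (entry X k) (a, i, b))"

text \<open>The index \<open>(i\<^sub>1, \<dots>, i\<^sub>d)\<close> is a list whose entry \<open>i\<^sub>k\<close> sits at position \<open>k - 1\<close>.\<close>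

definition tensor_index :: "nat \<Rightarrow> (nat \<Rightarrow> nat) \<Rightarrow> nat list set" where
  "tensor_index d n = {is. length is = d \<and> (\<forall>k\<in>{1..d}. is ! (k - 1) < n k)}"

text \<open>As \<open>r\<^sub>0 = r\<^sub>d = 1\<close>, the product of the slices is a 1-by-1 matrix.\<close>

definition tt_map :: "nat \<Rightarrow> (nat \<Rightarrow> nat) \<Rightarrow> (nat \<Rightarrow> nat) \<Rightarrow> cores \<Rightarrow> tensor" where
  "tt_map d n r X = on_support (tensor_index d n)
     (\<lambda>is. foldr (\<lambda>k A. slice r X k (is ! (k - 1)) * A) [1..<d + 1] (1\<^sub>m (r d)) $$ (0, 0))"

definition tt_manifold :: "nat \<Rightarrow> (nat \<Rightarrow> nat) \<Rightarrow> (nat \<Rightarrow> nat) \<Rightarrow> tensor set" where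
  "tt_manifold d n r = tt_map d n r ` total_space d n r"

definition mode1_prod :: "core \<Rightarrow> real mat \<Rightarrow> core" (infixl \<open>\<times>\<^sub>1\<close> 70) where
  "Z \<times>\<^sub>1 A = Abs_poly_mapping (\<lambda>(a, i, b).
     if a < dim_row A then \<Sum>a'<dim_col A. entry Z (a', i, b) * A $$ (a, a') else 0)"

definition mode3_prod :: "core \<Rightarrow> real mat \<Rightarrow> core" (infixl \<open>\<times>\<^sub>3\<close> 70) where
  "Z \<times>\<^sub>3 A = Abs_poly_mapping (\<lambda>(a, i, b).
     if b < dim_row A then \<Sum>b'<dim_col A. entry Z (a, i, b') * A $$ (b, b') else 0)"

lemma entry_mode1_prod:
  "entry (Z \<times>\<^sub>1 A) (a, i, b) =
     (if a < dim_row A then \<Sum>a'<dim_col A. entry Z (a', i, b) * A $$ (a, a') else 0)"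
proof -
  let ?f = "\<lambda>(a, i, b). if a < dim_row A
    then \<Sum>a'<dim_col A. entry Z (a', i, b) * A $$ (a, a') else (0::real)"
  have "{p. ?f p \<noteq> 0} \<subseteq> {..<dim_row A} \<times> snd ` Poly_Mapping.keys Z"
  proof (clarsimp split: if_splits)
    fix a i b
    assume "(\<Sum>a'<dim_col A. entry Z (a', i, b) * A $$ (a, a')) \<noteq> 0"
    then obtain a' where "entry Z (a', i, b) \<noteq> 0"
      by (metis (no_types, lifting) mult_zero_left sum.neutral)
    then show "(i, b) \<in> snd ` Poly_Mapping.keys Z"
      by (force simp: in_keys_iff image_iff)
  qed
  then have "finite {p. ?f p \<noteq> 0}"
    by (rule finite_subset) simp
  then show ?thesis
    unfolding mode1_prod_def by (simp add: Abs_poly_mapping_inverse)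
qed

lemma entry_mode3_prod:
  "entry (Z \<times>\<^sub>3 A) (a, i, b) =
     (if b < dim_row A then \<Sum>b'<dim_col A. entry Z (a, i, b') * A $$ (b, b') else 0)"
proof -
  let ?f = "\<lambda>(a, i, b). if b < dim_row A
    then \<Sum>b'<dim_col A. entry Z (a, i, b') * A $$ (b, b') else (0::real)"
  have "{p. ?f p \<noteq> 0} \<subseteq> (\<lambda>((a, i, _), b). (a, i, b)) ` (Poly_Mapping.keys Z \<times> {..<dim_row A})"
  proof (clarsimp split: if_splits)
    fix a i b
    assume b: "b < dim_row A"
    assume "(\<Sum>b'<dim_col A. entry Z (a, i, b') * A $$ (b, b')) \<noteq> 0"
    then obtain b' where "entry Z (a, i, b') \<noteq> 0"
      by (metis (no_types, lifting) mult_zero_left sum.neutral)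
    then have "((a, i, b'), b) \<in> Poly_Mapping.keys Z \<times> {..<dim_row A}"
      using b by (simp add: in_keys_iff)
    then show "(a, i, b) \<in> (\<lambda>((a, i, _), b). (a, i, b)) ` (Poly_Mapping.keys Z \<times> {..<dim_row A})"
      by (rule rev_image_eqI) simp
  qed
  then have "finite {p. ?f p \<noteq> 0}"
    by (rule finite_subset) simp
  then show ?thesis
    unfolding mode3_prod_def by (simp add: Abs_poly_mapping_inverse)
qed

definition vertical_space :: "nat \<Rightarrow> (nat \<Rightarrow> nat) \<Rightarrow> cores \<Rightarrow> cores set" where
  "vertical_space d r X =
     {on_support {1..d} (\<lambda>k.
        (if 1 < k then - (entry X k \<times>\<^sub>1 D (k - 1)) else 0) +
        (if k < d then entry X k \<times>\<^sub>3 transpose_mat (D k) else 0))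
      | D. \<forall>k\<in>{1..<d}. D k \<in> carrier_mat (r k) (r k)}"

definition precond_metric ::
    "nat \<Rightarrow> (nat \<Rightarrow> nat) \<Rightarrow> (nat \<Rightarrow> nat) \<Rightarrow> cores \<Rightarrow> cores \<Rightarrow> cores \<Rightarrow> real" where
  "precond_metric d n r X \<xi> \<eta> =
     (\<Sum>k=1..d. frobenius (tt_map d n r (Poly_Mapping.update k (entry \<xi> k) X))
                          (tt_map d n r (Poly_Mapping.update k (entry \<eta> k) X)))"

definition horizontal_space ::
    "nat \<Rightarrow> (nat \<Rightarrow> nat) \<Rightarrow> (nat \<Rightarrow> nat) \<Rightarrow> cores \<Rightarrow> cores set" where
  "horizontal_space d n r X =
     {\<xi> \<in> core_space d n r. \<forall>\<eta>\<in>vertical_space d r X. precond_metric d n r X \<xi> \<eta> = 0}"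


definition quotient_retraction :: "cores \<Rightarrow> cores \<Rightarrow> cores" where
  "quotient_retraction X \<xi> = X + \<xi>"

text \<open>
  The retraction \<open>R\<^sup>E\<close> at the tensor \<open>tt_map d n r X\<close>, expressed through its representative \<open>X\<close>.
\<close>

definition embedded_retraction ::
    "nat \<Rightarrow> (nat \<Rightarrow> nat) \<Rightarrow> (nat \<Rightarrow> nat) \<Rightarrow> cores \<Rightarrow> tensor \<Rightarrow> tensor" where
  "embedded_retraction d n r X \<xi> =
     tt_map d n r
       (the_inv_into (horizontal_space d n r X) (differential (core_space d n r) (tt_map d n r) X)
         (real d *\<^sub>R tt_map d n r X + \<xi>))"

end

theory Submission
  imports Defs
begin

text \<open>
  Write \<open>D\<phi>\<close> for the derivative of the TT map at \<open>X\<close>, \<open>M\<close> for the TT manifold and \<open>H\<close> for the horizontal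
  space. Everything rests on one fact: \<open>D\<phi>\<close> restricts to a linear bijection from \<open>H\<close> onto the tangent
  space \<open>T\<close> of \<open>M\<close> at \<open>\<phi>(X)\<close>.

  Given this, the two Gauss--Newton equations are the same equation. By the chain rule the
  differential of \<open>F \<circ> \<phi>\<close> is that of \<open>F\<close> composed with \<open>D\<phi>\<close>, and the test vectors \<open>D\<phi>[\<eta>]\<close>, for
  horizontal \<open>\<eta>\<close>, exhaust \<open>T\<close>. Hence \<open>D\<phi>\<close> maps a solution of the quotient equation to a solution of the
  embedded equation, which is unique. For the retractions, \<open>X\<close> is itself a horizontal vector: as \<open>\<phi>\<close> is
  multilinear, putting \<open>X\<close> into one argument of the metric gives
  \<open>g(X, \<eta>) = \<langle>\<phi>(X), D\<phi>[\<eta>]\<rangle>\<close> (\<open>metric_self\<close>), which vanishes on vertical vectors, and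
  \<open>D\<phi>[X] = d \<cdot> \<phi>(X)\<close>. So \<open>X + \<xi>\<close> is the horizontal vector that \<open>D\<phi>\<close> maps to \<open>d \<cdot> \<phi>(X) + D\<phi>[\<xi>]\<close>, and
  applying \<open>\<phi>\<close> to it yields both retractions.

  The bijection has three ingredients. They all use the interface matrices \<open>X\<^sub>\<le>\<^sub>k\<close> and \<open>X\<^sub>>\<^sub>k\<close>, the products
  of the slices on the two sides of a cut, and the left inverse \<open>L\<^sub>k\<close> of the former and the right
  inverse \<open>R\<^sub>k\<close> of the latter, which exist because the unfoldings of the cores have full rank.

  \<^item> The kernel of \<open>D\<phi>\<close> is the vertical space (\<open>vertical_space_eq_kernel\<close>). Gauge directions telescope
    to zero. Conversely, if \<open>D\<phi>[\<xi>] = 0\<close>, then contracting this tensor with \<open>L\<^sub>k\<close> and \<open>R\<^sub>k\<close> shows that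
    \<open>L\<^sub>k DX\<^sub>\<le>\<^sub>k[\<xi>]\<close> and \<open>DX\<^sub>>\<^sub>k[\<xi>] R\<^sub>k\<close> are negatives of each other, and contracting it around the core \<open>k + 1\<close>
    then expresses \<open>\<xi>\<^sup>k\<^sup>+\<^sup>1\<close> through these matrices, in the form required of a vertical vector.

  \<^item> The metric is positive definite, again by the one-sided inverses, so orthogonal projection
    splits off the vertical part of a vector. It follows that \<open>D\<phi>\<close> is injective on \<open>H\<close> and has there the
    same range as on the whole space (\<open>dphi_inj_on_horizontal\<close>, \<open>horizontal_lift\<close>).

  \<^item> The tangent space \<open>T\<close>, defined by velocities of smooth curves, is the range of \<open>D\<phi>\<close>
    (\<open>tangent_space_tt_manifold\<close>). One inclusion comes from the curves \<open>\<phi>(X + t Z)\<close>, since the rank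
    conditions are open. For the other one, a curve \<open>A(t)\<close> in \<open>M\<close> through \<open>\<phi>(X)\<close> is lifted explicitly:
    with \<open>G\<^sub>k(t) = L\<^sub>k A(t) R\<^sub>k\<close>, which is the identity at \<open>t = 0\<close>, the cores
    \<open>G\<^sub>k(t)\<inverse> L\<^sub>k A(t) R\<^sub>k\<^sub>+\<^sub>1\<close> (for \<open>k = 0\<close> without the first factor) represent \<open>A(t)\<close>, depend differentiably on \<open>t\<close>, and start at \<open>X\<close>
    (\<open>velocity_in_range_dphi\<close>).
\<close>

section \<open>Full rank and one-sided inverses\<close>

text \<open>
  If \<open>A\<close> is injective, then so is the square matrix \<open>A\<^sup>T A\<close>, because \<open>v\<^sup>T A\<^sup>T A v\<close> is the squared length of \<open>A v\<close>;
  hence \<open>(A\<^sup>T A)\<inverse> A\<^sup>T\<close> is a left inverse. Injectivity is linear independence of the columns, which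
  have to be shown distinct first since they are collected in a set.
\<close>

lemma full_column_rank_iff_left_inverse:
  fixes A :: "real mat"
  assumes A: "A \<in> carrier_mat m c"
  shows "vec_space.rank m A = c \<longleftrightarrow> (\<exists>K \<in> carrier_mat c m. K * A = 1\<^sub>m c)"
proof -
  interpret vec_space "TYPE(real)" m .
  show ?thesis
  proof
    assume rk: "rank A = c"
    \<comment> \<open>Equal columns would leave fewer than \<open>c\<close> vectors to span the column space.\<close>
    have dist: "distinct (cols A)"
    proof (rule ccontr)
      assume nd: "\<not> distinct (cols A)"
      obtain S where S: "maximal S (\<lambda>T. T \<subseteq> set (cols A) \<and> lin_indpt T)"
        using maximal_exists_superset[of "set (cols A)" "\<lambda>T. T \<subseteq> set (cols A) \<and> lin_indpt T" "{}"]
        by (metis (no_types, lifting) List.finite_set Set.empty_subsetI finite_basis_exists subset_li_is_li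
            vec_vs vectorspace.basis_def fin_dim)
      have "rank A = card S" by (rule rank_card_indpt[OF A S])
      also have "\<dots> \<le> card (set (cols A))" using S by (auto simp: maximal_def intro!: card_mono)
      also have "\<dots> < c" using nd A card_distinct[of "cols A"] card_length[of "cols A"]
        by (metis carrier_matD(2) cols_length le_neq_implies_less)
      finally show False using rk by simp
    qed
    have inj: "v = 0\<^sub>v c" if v: "v \<in> carrier_vec c" "A *\<^sub>v v = 0\<^sub>v m" for v
      using lin_depI[OF A v(1) _ v(2) dist] full_rank_lin_indpt[OF A rk dist] by blast
    define B where "B = transpose_mat A * A"
    have B: "B \<in> carrier_mat c c" using A by (auto simp: B_def)
    have "det B \<noteq> 0"
    proof
      assume "det B = 0"
      then obtain v where v: "v \<in> carrier_vec c" "v \<noteq> 0\<^sub>v c" "B *\<^sub>v v = 0\<^sub>v c"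
        using det_0_iff_vec_prod_zero_field[OF B] by blast
      have Av: "A *\<^sub>v v \<in> carrier_vec m" using A v by auto
      have "transpose_mat A *\<^sub>v (A *\<^sub>v v) = 0\<^sub>v c"
        using v A assoc_mult_mat_vec[of "transpose_mat A" c m A c v] by (auto simp: B_def)
      then have "v \<bullet> (transpose_mat A *\<^sub>v (A *\<^sub>v v)) = 0" using v by simp
      then have "(A *\<^sub>v v) \<bullet> (A *\<^sub>v v) = 0"
        using transpose_vec_mult_scalar[OF A v(1) Av] A v(1) Av
          comm_scalar_prod[of v c "transpose_mat A *\<^sub>v (A *\<^sub>v v)"]
        by (auto)
      moreover have "w = 0\<^sub>v m" if "w \<in> carrier_vec m" "w \<bullet> w = 0" for w :: "real vec"
        using that by (auto simp: scalar_prod_def sum_nonneg_eq_0_iff)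
      ultimately have "A *\<^sub>v v = 0\<^sub>v m" using Av by blast
      then show False using inj v by blast
    qed
    then have "B \<in> Units (ring_mat TYPE(real) c ())" by (rule det_non_zero_imp_unit[OF B])
    then obtain C where C: "C \<in> carrier_mat c c" "C * B = 1\<^sub>m c"
      unfolding Units_def by (auto simp: ring_mat_simps)
    have "(C * transpose_mat A) * A = 1\<^sub>m c"
      using C A by (simp add: B_def assoc_mult_mat[of C c c "transpose_mat A" m A c])
    then show "\<exists>K \<in> carrier_mat c m. K * A = 1\<^sub>m c"
      using C A by (intro bexI[of _ "C * transpose_mat A"]) auto
  next
    assume "\<exists>K \<in> carrier_mat c m. K * A = 1\<^sub>m c"
    then obtain K where K: "K \<in> carrier_mat c m" "K * A = 1\<^sub>m c" by blast
    have inj: "v = 0\<^sub>v c" if v: "v \<in> carrier_vec c" "A *\<^sub>v v = 0\<^sub>v m" for v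
    proof -
      have "v = (K * A) *\<^sub>v v" using K v by simp
      also have "\<dots> = K *\<^sub>v (A *\<^sub>v v)" using K A v by (intro assoc_mult_mat_vec) auto
      also have "\<dots> = 0\<^sub>v c" using K v by (auto intro!: eq_vecI)
      finally show ?thesis .
    qed
    have dist: "distinct (cols A)"
      unfolding distinct_conv_nth
    proof (intro allI impI notI)
      fix i j assume ij: "i < length (cols A)" "j < length (cols A)" "i \<noteq> j" "cols A ! i = cols A ! j"
      then have ij': "i < c" "j < c" "col A i = col A j" using A by auto
      have "(K * A) $$ (i, i) = (K * A) $$ (i, j)" using ij' K(1) A by auto
      then show False using K ij ij' by simp
    qed
    have "lin_indpt (set (cols A))" using lin_depE[OF A _ dist] inj by metis
    then show "rank A = c" by (rule lin_indpt_full_rank[OF A dist])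
  qed
qed

text \<open>
  Rank \<open>m\<close> means that the columns span the whole space, so that \<open>A x = e\<^sub>j\<close> is solvable for every unit
  vector; the solutions are the columns of the right inverse.
\<close>

lemma full_row_rank_iff_right_inverse:
  fixes A :: "real mat"
  assumes A: "A \<in> carrier_mat m c"
  shows "vec_space.rank m A = m \<longleftrightarrow> (\<exists>K \<in> carrier_mat c m. A * K = 1\<^sub>m m)"
proof -
  interpret vec_space "TYPE(real)" m .
  have cols: "set (cols A) \<subseteq> carrier_vec m" using A cols_dim by blast
  show ?thesis
  proof
    assume rk: "rank A = m"
    obtain S where S: "maximal S (\<lambda>T. T \<subseteq> set (cols A) \<and> lin_indpt T)"
      using maximal_exists_superset[of "set (cols A)" "\<lambda>T. T \<subseteq> set (cols A) \<and> lin_indpt T" "{}"]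
      by (metis (no_types, lifting) List.finite_set Set.empty_subsetI finite_basis_exists subset_li_is_li
          vec_vs vectorspace.basis_def fin_dim)
    have cS: "card S = m" using rank_card_indpt[OF A S] rk by simp
    have S': "S \<subseteq> set (cols A)" "lin_indpt S" using S by (auto simp: maximal_def)
    have "basis S"
      using S' cols cS dim_is_n by (intro dim_li_is_basis) (auto intro: finite_subset)
    then have "carrier_vec m \<subseteq> span S" by (auto simp: basis_def)
    also have "\<dots> \<subseteq> span (set (cols A))" using S' by (intro span_is_monotone)
    finally have "carrier_vec m \<subseteq> col_space A" by (simp add: col_space_def)
    then have sol: "\<exists>x \<in> carrier_vec c. A *\<^sub>v x = y" if "y \<in> carrier_vec m" for y
      using col_space_eq[OF A] that A by auto
    define s where "s j = (SOME x. x \<in> carrier_vec c \<and> A *\<^sub>v x = unit_vec m j)" for j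
    have s: "s j \<in> carrier_vec c" "A *\<^sub>v s j = unit_vec m j" for j
      using someI_ex[of "\<lambda>x. x \<in> carrier_vec c \<and> A *\<^sub>v x = unit_vec m j"] sol[of "unit_vec m j"]
      by (auto simp: s_def Bex_def)
    define K where "K = mat_of_cols c (map s [0..<m])"
    have K: "K \<in> carrier_mat c m" by (simp add: K_def mat_of_cols_def)
    have colK: "col K j = s j" if "j < m" for j
      using that s(1)[of j] unfolding K_def by (subst col_mat_of_cols) auto
    have "A * K = 1\<^sub>m m"
    proof (rule eq_matI)
      fix i j assume ij: "i < dim_row (1\<^sub>m m)" "j < dim_col (1\<^sub>m m)"
      have "(A * K) $$ (i, j) = (A *\<^sub>v s j) $ i" using ij A K colK by (simp)
      then show "(A * K) $$ (i, j) = 1\<^sub>m m $$ (i, j)" using ij by (auto simp: s unit_vec_def)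
    qed (use A K in auto)
    then show "\<exists>K \<in> carrier_mat c m. A * K = 1\<^sub>m m" using K by blast
  next
    assume "\<exists>K \<in> carrier_mat c m. A * K = 1\<^sub>m m"
    then obtain K where K: "K \<in> carrier_mat c m" "A * K = 1\<^sub>m m" by blast
    have "y \<in> col_space A" if y: "y \<in> carrier_vec m" for y
    proof -
      have "A *\<^sub>v (K *\<^sub>v y) = y" using A K y by (subst assoc_mult_mat_vec[symmetric]) auto
      then show ?thesis using col_space_eq[OF A] A K y
        by (auto intro!: exI[of _ "K *\<^sub>v y"] bexI[of _ "K *\<^sub>v y"])
    qed
    then have "span (set (cols A)) = carrier_vec m"
      using span_is_subset2[OF cols] by (auto simp: col_space_def)
    moreover have "vs (carrier_vec m) = V" by simp
    ultimately have "rank A = dim" unfolding rank_def by metis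
    then show "rank A = m" using dim_is_n by simp
  qed
qed

lemma sum_lessThan_mult:
  fixes f :: "nat \<Rightarrow> nat \<Rightarrow> 'a::comm_monoid_add"
  shows "(\<Sum>p<a * b. f (p mod a) (p div a)) = (\<Sum>i<a. \<Sum>j<b. f i j)"
proof -
  have "(\<Sum>p<a * b. f (p mod a) (p div a)) = (\<Sum>(i, j)\<in>{..<a} \<times> {..<b}. f i j)"
  proof (rule sum.reindex_bij_witness[of _ "\<lambda>(i, j). i + a * j" "\<lambda>p. (p mod a, p div a)"])
    fix p assume "p \<in> {..<a * b}"
    then have "p < a * b" "0 < a" by (auto intro!: Nat.gr0I)
    then show "(p mod a, p div a) \<in> {..<a} \<times> {..<b}"
      by (auto simp: less_mult_imp_div_less mult.commute)
  next
    fix q assume "q \<in> {..<a} \<times> {..<b}"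
    then obtain i j where q: "q = (i, j)" "i < a" "j < b" by auto
    have "i + a * j < a * Suc j" using q by simp
    also have "\<dots> \<le> a * b" using q by (intro mult_le_mono) auto
    finally show "(case q of (i, j) \<Rightarrow> i + a * j) \<in> {..<a * b}" using q by simp
  qed auto
  then show ?thesis by (simp add: sum.cartesian_product)
qed

text \<open>
  From here on full rank is used only in this form, free of the linear numbering \<open>i + a j\<close> of the
  rows of an unfolding.
\<close>

lemma left_unfolding_full_rank_iff:
  "vec_space.rank (a * b) (left_unfolding a b c Z) = c \<longleftrightarrow>
   (\<exists>K. \<forall>x<c. \<forall>y<c. (\<Sum>i<a. \<Sum>j<b. K x i j * entry Z (i, j, y)) = (if x = y then 1 else 0))"
proof -
  have A: "left_unfolding a b c Z \<in> carrier_mat (a * b) c" by (simp add: left_unfolding_def)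
  show ?thesis unfolding full_column_rank_iff_left_inverse[OF A]
  proof
    assume "\<exists>K\<in>carrier_mat c (a * b). K * left_unfolding a b c Z = 1\<^sub>m c"
    then obtain M where M: "M \<in> carrier_mat c (a * b)" "M * left_unfolding a b c Z = 1\<^sub>m c" by blast
    define K where "K x i j = M $$ (x, i + a * j)" for x i j
    have "(\<Sum>i<a. \<Sum>j<b. K x i j * entry Z (i, j, y)) = (if x = y then 1 else 0)"
      if "x < c" "y < c" for x y
    proof -
      have "(\<Sum>i<a. \<Sum>j<b. K x i j * entry Z (i, j, y)) =
            (\<Sum>p<a * b. K x (p mod a) (p div a) * entry Z (p mod a, p div a, y))"
        by (rule sum_lessThan_mult[symmetric])
      also have "\<dots> = (M * left_unfolding a b c Z) $$ (x, y)"
        using that M(1) by (auto simp: left_unfolding_def scalar_prod_def K_def lessThan_atLeast0 intro!: sum.cong)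
      finally show ?thesis using M that by simp
    qed
    then show "\<exists>K. \<forall>x<c. \<forall>y<c. (\<Sum>i<a. \<Sum>j<b. K x i j * entry Z (i, j, y)) = (if x = y then 1 else 0)"
      by blast
  next
    assume "\<exists>K. \<forall>x<c. \<forall>y<c. (\<Sum>i<a. \<Sum>j<b. K x i j * entry Z (i, j, y)) = (if x = y then 1 else 0)"
    then obtain K where
      K: "\<And>x y. x < c \<Longrightarrow> y < c \<Longrightarrow> (\<Sum>i<a. \<Sum>j<b. K x i j * entry Z (i, j, y)) = (if x = y then 1 else 0)"
      by blast
    define M where "M = mat c (a * b) (\<lambda>(x, p). K x (p mod a) (p div a))"
    have "M * left_unfolding a b c Z = 1\<^sub>m c"
    proof (rule eq_matI)
      fix x y assume xy: "x < dim_row (1\<^sub>m c)" "y < dim_col (1\<^sub>m c)"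
      then have "(M * left_unfolding a b c Z) $$ (x, y) =
            (\<Sum>p<a * b. K x (p mod a) (p div a) * entry Z (p mod a, p div a, y))"
        by (auto simp: left_unfolding_def scalar_prod_def M_def lessThan_atLeast0 intro!: sum.cong)
      also have "\<dots> = (\<Sum>i<a. \<Sum>j<b. K x i j * entry Z (i, j, y))" by (rule sum_lessThan_mult)
      finally show "(M * left_unfolding a b c Z) $$ (x, y) = 1\<^sub>m c $$ (x, y)" using K xy by simp
    qed (auto simp: M_def left_unfolding_def)
    then show "\<exists>K\<in>carrier_mat c (a * b). K * left_unfolding a b c Z = 1\<^sub>m c"
      by (intro bexI[of _ M]) (auto simp: M_def)
  qed
qed

lemma right_unfolding_full_rank_iff:
  "vec_space.rank a (right_unfolding a b c Z) = a \<longleftrightarrow>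
   (\<exists>K. \<forall>x<a. \<forall>y<a. (\<Sum>i<b. \<Sum>j<c. entry Z (x, i, j) * K i j y) = (if x = y then 1 else 0))"
proof -
  have A: "right_unfolding a b c Z \<in> carrier_mat a (b * c)" by (simp add: right_unfolding_def)
  show ?thesis unfolding full_row_rank_iff_right_inverse[OF A]
  proof
    assume "\<exists>K\<in>carrier_mat (b * c) a. right_unfolding a b c Z * K = 1\<^sub>m a"
    then obtain M where M: "M \<in> carrier_mat (b * c) a" "right_unfolding a b c Z * M = 1\<^sub>m a" by blast
    define K where "K i j y = M $$ (i + b * j, y)" for y i j
    have "(\<Sum>i<b. \<Sum>j<c. entry Z (x, i, j) * K i j y) = (if x = y then 1 else 0)"
      if "x < a" "y < a" for x y
    proof -
      have "(\<Sum>i<b. \<Sum>j<c. entry Z (x, i, j) * K i j y) =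
            (\<Sum>p<b * c. entry Z (x, p mod b, p div b) * K (p mod b) (p div b) y)"
        by (rule sum_lessThan_mult[symmetric])
      also have "\<dots> = (right_unfolding a b c Z * M) $$ (x, y)"
        using that M(1) by (auto simp: right_unfolding_def scalar_prod_def K_def lessThan_atLeast0 intro!: sum.cong)
      finally show ?thesis using M that by simp
    qed
    then show "\<exists>K. \<forall>x<a. \<forall>y<a. (\<Sum>i<b. \<Sum>j<c. entry Z (x, i, j) * K i j y) = (if x = y then 1 else 0)"
      by blast
  next
    assume "\<exists>K. \<forall>x<a. \<forall>y<a. (\<Sum>i<b. \<Sum>j<c. entry Z (x, i, j) * K i j y) = (if x = y then 1 else 0)"
    then obtain K where
      K: "\<And>x y. x < a \<Longrightarrow> y < a \<Longrightarrow> (\<Sum>i<b. \<Sum>j<c. entry Z (x, i, j) * K i j y) = (if x = y then 1 else 0)"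
      by blast
    define M where "M = mat (b * c) a (\<lambda>(p, y). K (p mod b) (p div b) y)"
    have "right_unfolding a b c Z * M = 1\<^sub>m a"
    proof (rule eq_matI)
      fix x y assume xy: "x < dim_row (1\<^sub>m a)" "y < dim_col (1\<^sub>m a)"
      then have "(right_unfolding a b c Z * M) $$ (x, y) =
            (\<Sum>p<b * c. entry Z (x, p mod b, p div b) * K (p mod b) (p div b) y)"
        by (auto simp: right_unfolding_def scalar_prod_def M_def lessThan_atLeast0 intro!: sum.cong)
      also have "\<dots> = (\<Sum>i<b. \<Sum>j<c. entry Z (x, i, j) * K i j y)" by (rule sum_lessThan_mult)
      finally show "(right_unfolding a b c Z * M) $$ (x, y) = 1\<^sub>m a $$ (x, y)" using K xy by simp
    qed (auto simp: M_def right_unfolding_def)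
    then show "\<exists>K\<in>carrier_mat (b * c) a. right_unfolding a b c Z * K = 1\<^sub>m a"
      by (intro bexI[of _ M]) (auto simp: M_def)
  qed
qed

lemma prod_differentiable:
  fixes f :: "'i \<Rightarrow> real \<Rightarrow> real"
  assumes "\<And>i. i \<in> I \<Longrightarrow> f i differentiable (at t)"
  shows "(\<lambda>s. \<Prod>i\<in>I. f i s) differentiable (at t)"
  using assms
proof (induction I rule: infinite_finite_induct)
  case (insert i I)
  have "(\<lambda>s. f i s * (\<Prod>i\<in>I. f i s)) differentiable (at t)"
    using insert by (intro differentiable_mult) auto
  then show ?case using insert by simp
qed simp_all

lemma det_differentiable:
  fixes A :: "real \<Rightarrow> real mat"
  assumes "\<And>t. A t \<in> carrier_mat m m"
    and "\<And>i j. i < m \<Longrightarrow> j < m \<Longrightarrow> (\<lambda>t. A t $$ (i, j)) differentiable (at t0)"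
  shows "(\<lambda>t. det (A t)) differentiable (at t0)"
proof -
  have "(\<lambda>t. \<Sum>p\<in>{p. p permutes {0..<m}}. signof p * (\<Prod>i = 0..<m. A t $$ (i, p i)))
          differentiable (at t0)"
  proof (intro differentiable_sum finite_permutations ballI differentiable_mult differentiable_const
        prod_differentiable)
    fix p i assume "p \<in> {p. p permutes {0..<m}}" "i \<in> {0..<m}"
    then have "i < m" "p i < m" using permutes_in_image[of p "{0..<m}" i] by auto
    then show "(\<lambda>t. A t $$ (i, p i)) differentiable (at t0)" by (rule assms(2))
  qed simp
  then show ?thesis by (simp add: det_def'[OF assms(1)])
qed

text \<open>
  By Cramer's rule the inverse of \<open>G(t)\<close> is the adjugate divided by the determinant. Its entries are
  differentiable where the determinant does not vanish, which it does not near \<open>t = 0\<close>.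
\<close>

lemma inverse_of_curve_through_one:
  fixes G :: "real \<Rightarrow> nat \<Rightarrow> nat \<Rightarrow> real"
  assumes diff: "\<And>i j. i < m \<Longrightarrow> j < m \<Longrightarrow> (\<lambda>t. G t i j) differentiable (at 0)"
    and G0: "\<And>i j. i < m \<Longrightarrow> j < m \<Longrightarrow> G 0 i j = (if i = j then 1 else 0)"
  shows "\<exists>H. (\<forall>i<m. \<forall>j<m. (\<lambda>t. H t i j) differentiable (at 0)) \<and>
    (\<forall>\<^sub>F t in nhds 0. \<forall>i<m. \<forall>j<m.
        (\<Sum>l<m. G t i l * H t l j) = (if i = j then 1 else 0) \<and>
        (\<Sum>l<m. H t i l * G t l j) = (if i = j then 1 else 0))"
proof -
  define A where "A t = mat m m (\<lambda>(i, j). G t i j)" for t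
  have A: "A t \<in> carrier_mat m m" for t by (simp add: A_def)
  have A0: "A 0 = 1\<^sub>m m" by (rule eq_matI) (auto simp: A_def G0)
  have det: "(\<lambda>t. det (A t)) differentiable (at 0)"
    by (rule det_differentiable[OF A]) (auto simp: A_def diff)
  have cof: "(\<lambda>t. cofactor (A t) j i) differentiable (at 0)" if "i < m" "j < m" for i j
  proof -
    have "(\<lambda>t. det (mat_delete (A t) j i)) differentiable (at 0)"
    proof (rule det_differentiable[of _ "m - 1"])
      show "mat_delete (A t) j i \<in> carrier_mat (m - 1) (m - 1)" for t
        using A[of t] by (auto simp: mat_delete_def)
      fix p q assume "p < m - 1" "q < m - 1"
      then show "(\<lambda>t. mat_delete (A t) j i $$ (p, q)) differentiable (at 0)"
        using that by (auto simp: mat_delete_def A_def diff)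
    qed
    then show ?thesis unfolding cofactor_def by (intro differentiable_mult) auto
  qed
  define H where "H t i j = cofactor (A t) j i / det (A t)" for t i j
  have d0: "det (A 0) \<noteq> 0" by (simp add: A0)
  have "(\<lambda>t. H t i j) differentiable (at 0)" if "i < m" "j < m" for i j
    unfolding H_def using cof[OF that] det d0 by (rule differentiable_divide)
  moreover have "\<forall>\<^sub>F t in nhds 0. det (A t) \<noteq> 0"
  proof -
    have "isCont (\<lambda>t. det (A t)) 0" using det by (rule differentiable_imp_continuous_within)
    then have "\<forall>\<^sub>F t in at 0. det (A t) \<noteq> 0"
      using d0 by (simp add: isCont_def tendsto_imp_eventually_ne)
    then show ?thesis using d0 by (simp add: eventually_nhds_conv_at)
  qed
  then have "\<forall>\<^sub>F t in nhds 0. \<forall>i<m. \<forall>j<m.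
        (\<Sum>l<m. G t i l * H t l j) = (if i = j then 1 else 0) \<and>
        (\<Sum>l<m. H t i l * G t l j) = (if i = j then 1 else 0)"
  proof (rule eventually_mono, intro allI impI conjI)
    fix t i j assume dt: "det (A t) \<noteq> 0" and ij: "i < m" "j < m"
    have adj: "adj_mat (A t) $$ (p, q) = det (A t) * H t p q" if "p < m" "q < m" for p q
      using that dt A[of t] by (auto simp: adj_mat_def H_def)
    have dims: "dim_row (adj_mat (A t)) = m" "dim_col (adj_mat (A t)) = m" "dim_row (A t) = m" "dim_col (A t) = m"
      using adj_mat(1)[OF A[of t]] A[of t] by auto
    have At: "A t $$ (p, q) = G t p q" if "p < m" "q < m" for p q
      using that by (simp add: A_def)
    have "(A t * adj_mat (A t)) $$ (i, j) = (\<Sum>l<m. G t i l * (det (A t) * H t l j))"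
      using ij dims by (auto simp: scalar_prod_def adj At lessThan_atLeast0 intro!: sum.cong)
    also have "\<dots> = det (A t) * (\<Sum>l<m. G t i l * H t l j)"
      by (simp add: sum_distrib_left mult.left_commute)
    finally have "(A t * adj_mat (A t)) $$ (i, j) = det (A t) * (\<Sum>l<m. G t i l * H t l j)" .
    moreover have "(A t * adj_mat (A t)) $$ (i, j) = det (A t) * (if i = j then 1 else 0)"
      using ij by (simp add: adj_mat(2)[OF A[of t]])
    ultimately have "det (A t) * (\<Sum>l<m. G t i l * H t l j) = det (A t) * (if i = j then 1 else 0)"
      by (rule trans[OF sym])
    then show "(\<Sum>l<m. G t i l * H t l j) = (if i = j then 1 else 0)"
      by (rule mult_left_cancel[OF dt, THEN iffD1])
    have "(adj_mat (A t) * A t) $$ (i, j) = (\<Sum>l<m. (det (A t) * H t i l) * G t l j)"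
      using ij dims by (auto simp: scalar_prod_def adj At lessThan_atLeast0 intro!: sum.cong)
    also have "\<dots> = det (A t) * (\<Sum>l<m. H t i l * G t l j)"
      by (simp add: sum_distrib_left mult.assoc)
    finally have "(adj_mat (A t) * A t) $$ (i, j) = det (A t) * (\<Sum>l<m. H t i l * G t l j)" .
    moreover have "(adj_mat (A t) * A t) $$ (i, j) = det (A t) * (if i = j then 1 else 0)"
      using ij by (simp add: adj_mat(3)[OF A[of t]])
    ultimately have "det (A t) * (\<Sum>l<m. H t i l * G t l j) = det (A t) * (if i = j then 1 else 0)"
      by (rule trans[OF sym])
    then show "(\<Sum>l<m. H t i l * G t l j) = (if i = j then 1 else 0)"
      by (rule mult_left_cancel[OF dt, THEN iffD1])
  qed
  ultimately show ?thesis by blast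
qed

lemma left_right_inverse_entrywise:
  fixes A B :: "nat \<Rightarrow> nat \<Rightarrow> real"
  assumes AB: "\<And>i j. i < m \<Longrightarrow> j < m \<Longrightarrow> (\<Sum>l<m. A i l * B l j) = (if i = j then 1 else 0)"
    and ij: "i < m" "j < m"
  shows "(\<Sum>l<m. B i l * A l j) = (if i = j then 1 else 0)"
proof -
  let ?A = "mat m m (\<lambda>(i, j). A i j)" and ?B = "mat m m (\<lambda>(i, j). B i j)"
  have "?A * ?B = 1\<^sub>m m"
    by (rule eq_matI) (auto simp: scalar_prod_def AB lessThan_atLeast0[symmetric])
  then have "?B * ?A = 1\<^sub>m m" by (rule mat_mult_left_right_inverse[rotated 2]) auto
  moreover have "(?B * ?A) $$ (i, j) = (\<Sum>l<m. B i l * A l j)"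
    using ij by (auto simp: scalar_prod_def lessThan_atLeast0[symmetric])
  ultimately show ?thesis using ij by simp
qed

section \<open>Products of slices\<close>

text \<open>
  Matrices are plain functions of a row and a column index, and the product carries the set of inner
  indices. In this form multi-indices (lists) can be rows or columns just like numbers, and
  associativity holds without conditions on dimensions; only the unit laws need indices in range.
\<close>

definition mprod :: "'c set \<Rightarrow> ('a \<Rightarrow> 'c \<Rightarrow> real) \<Rightarrow> ('c \<Rightarrow> 'b \<Rightarrow> real) \<Rightarrow> 'a \<Rightarrow> 'b \<Rightarrow> real" where
  "mprod S A B = (\<lambda>a b. \<Sum>c\<in>S. A a c * B c b)"

definition is_one :: "nat \<Rightarrow> (nat \<Rightarrow> nat \<Rightarrow> real) \<Rightarrow> bool" where
  "is_one m A \<longleftrightarrow> (\<forall>x<m. \<forall>y<m. A x y = (if x = y then 1 else 0))"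

lemma mprod_assoc: "mprod S (mprod T A B) C = mprod T A (mprod S B C)"
proof (intro ext)
  fix a b
  have "mprod S (mprod T A B) C a b = (\<Sum>c\<in>S. \<Sum>e\<in>T. A a e * B e c * C c b)"
    by (simp add: mprod_def sum_distrib_right)
  also have "\<dots> = (\<Sum>e\<in>T. \<Sum>c\<in>S. A a e * B e c * C c b)" by (rule sum.swap)
  also have "\<dots> = mprod T A (mprod S B C) a b"
    by (simp add: mprod_def sum_distrib_left mult.assoc)
  finally show "mprod S (mprod T A B) C a b = mprod T A (mprod S B C) a b" .
qed

text \<open>
  The contraction of a tensor \<open>A Z B\<close> from both sides, the step by which one-sided inverses of \<open>A\<close> and
  \<open>B\<close> isolate \<open>Z\<close>.
\<close>

lemma mprod_sandwich: "mprod P L (mprod S (mprod M A (mprod N Z B)) R) = mprod M (mprod P L A) (mprod N Z (mprod S B R))"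
  by (simp only: mprod_assoc)

lemma mprod_cong:
  "(\<And>c. c \<in> S \<Longrightarrow> A a c = A' a c) \<Longrightarrow> (\<And>c. c \<in> S \<Longrightarrow> B c b = B' c b) \<Longrightarrow>
    mprod S A B a b = mprod S A' B' a b"
  by (simp add: mprod_def cong: sum.cong)

lemma mprod_one_left: "is_one m A \<Longrightarrow> a < m \<Longrightarrow> mprod {..<m} A B a b = B a b"
proof -
  assume A: "is_one m A" "a < m"
  have "mprod {..<m} A B a b = (\<Sum>c\<in>{..<m}. if a = c then B c b else 0)"
    unfolding mprod_def using A by (intro sum.cong) (auto simp: is_one_def)
  then show ?thesis using A by simp
qed

lemma mprod_id_left: "(a::nat) < m \<Longrightarrow> mprod {..<m} (\<lambda>a b. if a = b then 1 else 0) B a b = B a b"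
  by (simp add: mprod_one_left is_one_def)

lemma mprod_one_right: "is_one m B \<Longrightarrow> b < m \<Longrightarrow> mprod {..<m} A B a b = A a b"
proof -
  assume B: "is_one m B" "b < m"
  have "mprod {..<m} A B a b = (\<Sum>c\<in>{..<m}. if c = b then A a c else 0)"
    unfolding mprod_def using B by (intro sum.cong) (auto simp: is_one_def)
  then show ?thesis using B by simp
qed

lemma mprod_is_one: "is_one m A \<Longrightarrow> is_one m B \<Longrightarrow> is_one m (mprod {..<m} A B)"
  by (simp add: is_one_def[of m "mprod {..<m} A B"] mprod_one_left) (simp add: is_one_def)

lemma is_one_swap: "is_one m (mprod {..<m} A B) \<Longrightarrow> is_one m (mprod {..<m} B A)"
  unfolding is_one_def mprod_def using left_right_inverse_entrywise[of m A B] by blast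

lemma mprod_add_left: "mprod S (\<lambda>a c. A a c + A' a c) B = (\<lambda>a b. mprod S A B a b + mprod S A' B a b)"
  by (simp add: mprod_def distrib_right sum.distrib)

lemma mprod_add_right: "mprod S A (\<lambda>c b. B c b + B' c b) = (\<lambda>a b. mprod S A B a b + mprod S A B' a b)"
  by (simp add: mprod_def distrib_left sum.distrib)

lemma mprod_scale_left: "mprod S (\<lambda>a c. k * A a c) B = (\<lambda>a b. k * mprod S A B a b)"
  by (simp add: mprod_def sum_distrib_left mult.assoc)

lemma mprod_scale_right: "mprod S A (\<lambda>c b. k * B c b) = (\<lambda>a b. k * mprod S A B a b)"
  by (simp add: mprod_def sum_distrib_left mult.left_commute)

lemma mprod_minus_right: "mprod S A (\<lambda>c b. - B c b) = (\<lambda>a b. - mprod S A B a b)"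
  by (simp add: mprod_def sum_negf)

lemma mprod_diff_left: "mprod S (\<lambda>a c. A a c - A' a c) B = (\<lambda>a b. mprod S A B a b - mprod S A' B a b)"
  by (simp add: mprod_def left_diff_distrib sum_subtractf)

lemma mprod_diff_right: "mprod S A (\<lambda>c b. B c b - B' c b) = (\<lambda>a b. mprod S A B a b - mprod S A B' a b)"
  by (simp add: mprod_def right_diff_distrib sum_subtractf)

lemma mprod_zero_left: "(\<And>c. c \<in> S \<Longrightarrow> A a c = 0) \<Longrightarrow> mprod S A B a b = 0"
  by (simp add: mprod_def)

lemma mprod_zero_right: "(\<And>c. c \<in> S \<Longrightarrow> B c b = 0) \<Longrightarrow> mprod S A B a b = 0"
  by (simp add: mprod_def)

lemma lookup_scaleR [simp]: "entry (c *\<^sub>R X) k = c *\<^sub>R entry X k"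
  by (simp add: scaleR_poly_mapping_def Poly_Mapping.map.rep_eq)

definition core_slice :: "cores \<Rightarrow> nat \<Rightarrow> nat \<Rightarrow> nat \<Rightarrow> nat \<Rightarrow> real" where
  "core_slice X k i = (\<lambda>a b. entry (entry X k) (a, i, b))"

text \<open>
  \<open>chain r X k s\<close> is \<open>X\<^sup>k\<^sup>+\<^sup>1(s\<^sub>0) X\<^sup>k\<^sup>+\<^sup>2(s\<^sub>1) \<dots>\<close>, the product of the slices picked by the list \<open>s\<close>, starting with the
  core after the cut \<open>k\<close>. \<open>dchain r X Z k s\<close> is its derivative in the direction \<open>Z\<close>.
\<close>

primrec chain :: "(nat \<Rightarrow> nat) \<Rightarrow> cores \<Rightarrow> nat \<Rightarrow> nat list \<Rightarrow> nat \<Rightarrow> nat \<Rightarrow> real" where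
  "chain r X k [] = (\<lambda>a b. if a = b then 1 else 0)"
| "chain r X k (i # s) = mprod {..<r (Suc k)} (core_slice X (Suc k) i) (chain r X (Suc k) s)"

primrec dchain :: "(nat \<Rightarrow> nat) \<Rightarrow> cores \<Rightarrow> cores \<Rightarrow> nat \<Rightarrow> nat list \<Rightarrow> nat \<Rightarrow> nat \<Rightarrow> real" where
  "dchain r X Z k [] = (\<lambda>a b. 0)"
| "dchain r X Z k (i # s) = (\<lambda>a b. mprod {..<r (Suc k)} (core_slice Z (Suc k) i) (chain r X (Suc k) s) a b +
     mprod {..<r (Suc k)} (core_slice X (Suc k) i) (dchain r X Z (Suc k) s) a b)"

lemma is_one_chain_Nil: "is_one m (chain r X k [])"
  by (simp add: is_one_def)

lemma chain_cong:
  "(\<And>j. k < j \<Longrightarrow> j \<le> k + length s \<Longrightarrow> entry X j = entry Y j) \<Longrightarrow> chain r X k s = chain r Y k s"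
proof (induction s arbitrary: k)
  case (Cons i s)
  have "chain r X (Suc k) s = chain r Y (Suc k) s" using Cons.prems by (intro Cons.IH) auto
  moreover have "core_slice X (Suc k) i = core_slice Y (Suc k) i" using Cons.prems[of "Suc k"] by (simp add: core_slice_def)
  ultimately show ?case by simp
qed simp

lemma chain_append:
  assumes "a < r k"
  shows "chain r X k (p @ s) a b = mprod {..<r (k + length p)} (chain r X k p) (chain r X (k + length p) s) a b"
  using assms
proof (induction p arbitrary: k a)
  case Nil
  then show ?case by (simp add: mprod_id_left)
next
  case (Cons i p)
  have "chain r X k ((i # p) @ s) a b =
      mprod {..<r (Suc k)} (core_slice X (Suc k) i)
        (mprod {..<r (Suc k + length p)} (chain r X (Suc k) p) (chain r X (Suc k + length p) s)) a b"
    using Cons.IH[of _ "Suc k"] by (auto intro!: mprod_cong)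
  then show ?case by (simp add: mprod_assoc)
qed

lemma dchain_append:
  assumes "a < r k"
  shows "dchain r X Z k (p @ s) a b =
    mprod {..<r (k + length p)} (dchain r X Z k p) (chain r X (k + length p) s) a b +
    mprod {..<r (k + length p)} (chain r X k p) (dchain r X Z (k + length p) s) a b"
  using assms
proof (induction p arbitrary: k a)
  case Nil
  then show ?case by (simp add: mprod_id_left mprod_zero_left)
next
  case (Cons i p)
  let ?m = "{..<r (Suc k + length p)}" and ?C = "chain r X (Suc k + length p) s"
    and ?D = "dchain r X Z (Suc k + length p) s"
  have "dchain r X Z k ((i # p) @ s) a b =
      mprod {..<r (Suc k)} (core_slice Z (Suc k) i) (mprod ?m (chain r X (Suc k) p) ?C) a b +
      mprod {..<r (Suc k)} (core_slice X (Suc k) i)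
         (\<lambda>a b. mprod ?m (dchain r X Z (Suc k) p) ?C a b + mprod ?m (chain r X (Suc k) p) ?D a b) a b"
    using Cons.IH[of _ "Suc k"] chain_append[of _ r "Suc k" X p s]
    by (auto intro!: mprod_cong arg_cong2[of _ _ _ _ "(+)"])
  also have "\<dots> = mprod ?m (dchain r X Z k (i # p)) ?C a b + mprod ?m (chain r X k (i # p)) ?D a b"
    by (simp add: mprod_add_left mprod_add_right mprod_assoc)
  finally show ?case by simp
qed

text \<open>
  The derivative of a product, in the form that matches the definition of the metric: one summand
  for each core, with that core replaced.
\<close>

lemma dchain_eq_sum_chain_update:
  "dchain r X Z k s a b = (\<Sum>j\<in>{k<..k + length s}. chain r (Poly_Mapping.update j (entry Z j) X) k s a b)"
proof (induction s arbitrary: k a)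
  case (Cons i s)
  let ?U = "\<lambda>j. Poly_Mapping.update j (entry Z j) X"
  have split: "{k<..k + length (i # s)} = insert (Suc k) {Suc k<..Suc k + length s}" by auto
  have 1: "chain r (?U (Suc k)) k (i # s) a b =
      mprod {..<r (Suc k)} (core_slice Z (Suc k) i) (chain r X (Suc k) s) a b"
  proof -
    have "chain r (?U (Suc k)) (Suc k) s = chain r X (Suc k) s"
      by (rule chain_cong) (simp add: lookup_update)
    then show ?thesis by (simp add: core_slice_def lookup_update)
  qed
  have 2: "chain r (?U j) k (i # s) a b =
      mprod {..<r (Suc k)} (core_slice X (Suc k) i) (chain r (?U j) (Suc k) s) a b"
    if "j \<in> {Suc k<..Suc k + length s}" for j
    using that by (simp add: core_slice_def lookup_update)
  have 3: "(\<Sum>j\<in>{Suc k<..Suc k + length s}. mprod {..<r (Suc k)} (core_slice X (Suc k) i) (chain r (?U j) (Suc k) s) a b)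
      = mprod {..<r (Suc k)} (core_slice X (Suc k) i) (dchain r X Z (Suc k) s) a b"
    unfolding mprod_def Cons.IH sum_distrib_left by (rule sum.swap)
  have "(\<Sum>j\<in>{k<..k + length (i # s)}. chain r (?U j) k (i # s) a b) =
      chain r (?U (Suc k)) k (i # s) a b + (\<Sum>j\<in>{Suc k<..Suc k + length s}. chain r (?U j) k (i # s) a b)"
    unfolding split by (rule sum.insert) auto
  also have "\<dots> = dchain r X Z k (i # s) a b"
    unfolding 1 by (simp only: sum.cong[OF refl 2] 3 dchain.simps)
  finally show ?case by (rule sym)
qed simp

section \<open>Multi-indices\<close>

text \<open>Multi-indices for the \<open>m\<close> modes that follow the cut \<open>k\<close>.\<close>

definition index_box :: "(nat \<Rightarrow> nat) \<Rightarrow> nat \<Rightarrow> nat \<Rightarrow> nat list set" where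
  "index_box n k m = {s. length s = m \<and> (\<forall>j<m. s ! j < n (Suc (k + j)))}"

lemma tensor_index_eq_index_box: "tensor_index d n = index_box n 0 d"
proof -
  have "(\<forall>k\<in>{1..d}. s ! (k - 1) < n k) \<longleftrightarrow> (\<forall>j<d. s ! j < n (Suc j))" for s :: "nat list"
  proof
    assume "\<forall>k\<in>{1..d}. s ! (k - 1) < n k"
    then show "\<forall>j<d. s ! j < n (Suc j)" by force
  next
    assume h: "\<forall>j<d. s ! j < n (Suc j)"
    show "\<forall>k\<in>{1..d}. s ! (k - 1) < n k"
    proof
      fix k assume "k \<in> {1..d}"
      then show "s ! (k - 1) < n k" using h by (cases k) auto
    qed
  qed
  then show ?thesis by (auto simp: tensor_index_def index_box_def)
qed

lemma index_box_0 [simp]: "index_box n k 0 = {[]}"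
  by (auto simp: index_box_def)

lemma index_box_Suc: "index_box n k (Suc m) = (\<lambda>(i, s). i # s) ` ({..<n (Suc k)} \<times> index_box n (Suc k) m)"
proof (intro Set.set_eqI iffI)
  fix s assume "s \<in> index_box n k (Suc m)"
  then obtain i t where "s = i # t" "length t = m" "\<forall>j<Suc m. s ! j < n (Suc (k + j))"
    by (cases s) (auto simp: index_box_def)
  then show "s \<in> (\<lambda>(i, s). i # s) ` ({..<n (Suc k)} \<times> index_box n (Suc k) m)"
    by (fastforce simp: index_box_def image_iff)
qed (auto simp: index_box_def less_Suc_eq_0_disj)

lemma finite_index_box [simp]: "finite (index_box n k m)"
  by (induction m arbitrary: k) (auto simp: index_box_Suc)

lemma index_box_append:
  assumes "p \<in> index_box n k l" "s \<in> index_box n (k + l) m"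
  shows "p @ s \<in> index_box n k (l + m)"
  unfolding index_box_def
proof (intro CollectI conjI allI impI)
  fix j assume j: "j < l + m"
  show "(p @ s) ! j < n (Suc (k + j))"
  proof (cases "j < l")
    case False
    have "\<And>i. i < m \<Longrightarrow> s ! i < n (Suc (k + l + i))" using assms(2) by (simp add: index_box_def)
    from this[of "j - l"] show ?thesis using False j assms by (simp add: nth_append index_box_def)
  qed (use assms in \<open>simp add: nth_append index_box_def\<close>)
qed (use assms in \<open>simp add: index_box_def\<close>)

lemma sum_index_box_Suc: "(\<Sum>s\<in>index_box n k (Suc m). f s) = (\<Sum>i<n (Suc k). \<Sum>s\<in>index_box n (Suc k) m. f (i # s))"
proof -
  have "(\<Sum>s\<in>index_box n k (Suc m). f s) = (\<Sum>(i, s)\<in>{..<n (Suc k)} \<times> index_box n (Suc k) m. f (i # s))"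
    unfolding index_box_Suc by (subst sum.reindex) (auto simp: inj_on_def case_prod_beta)
  then show ?thesis by (simp add: sum.cartesian_product)
qed

lemma sum_index_box_snoc: "(\<Sum>s\<in>index_box n k (Suc m). f s) = (\<Sum>p\<in>index_box n k m. \<Sum>i<n (Suc (k + m)). f (p @ [i]))"
proof (induction m arbitrary: k f)
  case 0
  then show ?case by (simp add: sum_index_box_Suc)
next
  case (Suc m)
  have "(\<Sum>s\<in>index_box n k (Suc (Suc m)). f s) =
      (\<Sum>i<n (Suc k). \<Sum>s\<in>index_box n (Suc k) (Suc m). f (i # s))"
    by (rule sum_index_box_Suc)
  also have "\<dots> = (\<Sum>i<n (Suc k). \<Sum>p\<in>index_box n (Suc k) m. \<Sum>j<n (Suc (Suc k + m)). f (i # p @ [j]))"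
    by (simp only: Suc.IH)
  also have "\<dots> = (\<Sum>p\<in>index_box n k (Suc m). \<Sum>i<n (Suc (k + Suc m)). f (p @ [i]))"
    by (simp add: sum_index_box_Suc)
  finally show ?case .
qed

section \<open>The TT map and its derivative in coordinates\<close>

locale tt_format =
  fixes d :: nat and n r :: "nat \<Rightarrow> nat"
  assumes d_pos: "1 \<le> d" and r_0: "r 0 = 1" and r_d: "r d = 1"
begin

abbreviation "E \<equiv> core_space d n r"
abbreviation "\<phi> \<equiv> tt_map d n r"
abbreviation "C \<equiv> chain r"
abbreviation "DC \<equiv> dchain r"

text \<open>
  The partial products in the definition of the TT map, from the right end down to the cut \<open>j\<close>, are
  chains over the tail of the multi-index.
\<close>

lemma foldr_slice_eq_chain:
  assumes "length is = d" "j \<le> d"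
  shows "foldr (\<lambda>k A. slice r X k (is ! (k - 1)) * A) [Suc j..<Suc d] (1\<^sub>m (r d)) \<in> carrier_mat (r j) (r d)
   \<and> (\<forall>a<r j. \<forall>b<r d. foldr (\<lambda>k A. slice r X k (is ! (k - 1)) * A) [Suc j..<Suc d] (1\<^sub>m (r d)) $$ (a, b) = C X j (drop j is) a b)"
  using assms(2)
proof (induction j rule: inc_induct)
  case base
  then show ?case using assms by simp
next
  case (step j)
  define M where "M j = foldr (\<lambda>k A. slice r X k (is ! (k - 1)) * A) [Suc j..<Suc d] (1\<^sub>m (r d))" for j
  have M: "M j = slice r X (Suc j) (is ! j) * M (Suc j)"
    unfolding M_def using step by (subst upt_conv_Cons) auto
  have core_slice: "slice r X (Suc j) (is ! j) \<in> carrier_mat (r j) (r (Suc j))" by (simp add: slice_def)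
  have dr: "drop j is = is ! j # drop (Suc j) is" using step assms by (simp add: Cons_nth_drop_Suc)
  have IH: "M (Suc j) \<in> carrier_mat (r (Suc j)) (r d)"
    "\<And>a b. a < r (Suc j) \<Longrightarrow> b < r d \<Longrightarrow> M (Suc j) $$ (a, b) = C X (Suc j) (drop (Suc j) is) a b"
    using step.IH unfolding M_def by auto
  have ent: "slice r X (Suc j) (is ! j) $$ (a, c) = core_slice X (Suc j) (is ! j) a c" if "a < r j" "c < r (Suc j)" for a c
    using that by (simp add: slice_def core_slice_def)
  have "M j $$ (a, b) = C X j (drop j is) a b" if "a < r j" "b < r d" for a b
  proof -
    have "M j $$ (a, b) = (\<Sum>c<r (Suc j). slice r X (Suc j) (is ! j) $$ (a, c) * M (Suc j) $$ (c, b))"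
      unfolding M using that core_slice IH(1) by (auto simp: scalar_prod_def lessThan_atLeast0 intro!: sum.cong)
    also have "\<dots> = C X j (drop j is) a b"
      using that by (auto simp: dr mprod_def ent IH(2) intro!: sum.cong)
    finally show ?thesis .
  qed
  then show ?case using core_slice IH(1) unfolding M_def[symmetric] by (simp add: M)
qed

lemma entry_tt_map: "entry (\<phi> X) is = (if is \<in> index_box n 0 d then C X 0 is 0 0 else 0)"
proof -
  have "foldr (\<lambda>k A. slice r X k (is ! (k - 1)) * A) [1..<d + 1] (1\<^sub>m (r d)) $$ (0, 0) = C X 0 is 0 0"
    if "is \<in> index_box n 0 d"
    using foldr_slice_eq_chain[of "is" 0 X] that r_0 r_d by (simp add: index_box_def)
  then show ?thesis
    by (simp add: tt_map_def entry_on_support tensor_index_eq_index_box)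
qed

text \<open>The directional derivative of \<open>\<phi>\<close> at \<open>X\<close>, by multilinearity; see \<open>has_derivative_phi\<close>.\<close>

definition d\<phi> :: "cores \<Rightarrow> cores \<Rightarrow> tensor" where
  "d\<phi> X Z = (\<Sum>k=1..d. \<phi> (Poly_Mapping.update k (entry Z k) X))"

lemma entry_d\<phi>: "entry (d\<phi> X Z) is = (if is \<in> index_box n 0 d then DC X Z 0 is 0 0 else 0)"
proof -
  have "{0<..d} = {1..d}" by auto
  moreover have "length is = d" if "is \<in> index_box n 0 d" using that by (simp add: index_box_def)
  ultimately show ?thesis
    by (simp add: d\<phi>_def lookup_sum entry_tt_map dchain_eq_sum_chain_update)
qed

section \<open>Interface matrices\<close>

text \<open>
  \<open>left_part X\<close> is \<open>X\<^sub>\<le>\<^sub>k\<close>, with rows indexed by the lists of length \<open>k\<close>, and \<open>right_part X k\<close> is \<open>X\<^sub>>\<^sub>k\<close>, with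
  columns indexed by the lists of length \<open>d - k\<close>. Together they factor the \<open>k\<close>-th unfolding of the tensor
  (\<open>chain_split\<close>). The outer boundary index is \<open>0\<close> because the outermost ranks are 1.
\<close>

definition left_part :: "cores \<Rightarrow> nat list \<Rightarrow> nat \<Rightarrow> real" where
  "left_part X = (\<lambda>p c. C X 0 p 0 c)"
definition right_part :: "cores \<Rightarrow> nat \<Rightarrow> nat \<Rightarrow> nat list \<Rightarrow> real" where
  "right_part X k = (\<lambda>c s. C X k s c 0)"
definition d_left_part :: "cores \<Rightarrow> cores \<Rightarrow> nat list \<Rightarrow> nat \<Rightarrow> real" where
  "d_left_part X Z = (\<lambda>p c. DC X Z 0 p 0 c)"
definition d_right_part :: "cores \<Rightarrow> cores \<Rightarrow> nat \<Rightarrow> nat \<Rightarrow> nat list \<Rightarrow> real" where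
  "d_right_part X Z k = (\<lambda>c s. DC X Z k s c 0)"

lemma right_part_Cons: "right_part X k c (i # s) = mprod {..<r (Suc k)} (core_slice X (Suc k) i) (right_part X (Suc k)) c s"
  by (simp add: right_part_def mprod_def)

lemma d_right_part_Cons: "d_right_part X Z k c (i # s) =
    mprod {..<r (Suc k)} (core_slice Z (Suc k) i) (right_part X (Suc k)) c s +
    mprod {..<r (Suc k)} (core_slice X (Suc k) i) (d_right_part X Z (Suc k)) c s"
  by (simp add: right_part_def d_right_part_def mprod_def)

lemma left_part_snoc:
  assumes "length p = k" "c < r (Suc k)"
  shows "left_part X (p @ [i]) c = mprod {..<r k} (left_part X) (core_slice X (Suc k) i) p c"
proof -
  have "C X k [i] b c = core_slice X (Suc k) i b c" for b
    using assms by (simp add: mprod_one_right[OF is_one_chain_Nil[of "r (Suc k)" r X "Suc k", simplified]])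
  then show ?thesis using assms r_0 by (simp add: left_part_def chain_append mprod_def del: chain.simps)
qed

lemma chain_split: "length p = k \<Longrightarrow> C X 0 (p @ s) 0 0 = mprod {..<r k} (left_part X) (right_part X k) p s"
  using r_0 by (simp add: chain_append left_part_def right_part_def mprod_def)

lemma dchain_split: "length p = k \<Longrightarrow> DC X Z 0 (p @ s) 0 0 =
    mprod {..<r k} (d_left_part X Z) (right_part X k) p s + mprod {..<r k} (left_part X) (d_right_part X Z k) p s"
  using r_0 by (simp add: dchain_append left_part_def right_part_def d_left_part_def d_right_part_def mprod_def)

lemma core_left_inverse:
  assumes "X \<in> total_space d n r" "Suc k \<le> d"
  obtains K where "\<And>x y. x < r (Suc k) \<Longrightarrow> y < r (Suc k) \<Longrightarrow>
     (\<Sum>i<n (Suc k). mprod {..<r k} (\<lambda>x a. K x a i) (core_slice X (Suc k) i) x y) = (if x = y then 1 else 0)"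
proof -
  have "Suc k \<in> {1..d}" using assms by simp
  then have "vec_space.rank (r (Suc k - 1) * n (Suc k))
     (left_unfolding (r (Suc k - 1)) (n (Suc k)) (r (Suc k)) (entry X (Suc k))) = r (Suc k)"
    using assms(1) unfolding total_space_def by blast
  then obtain K where K: "\<And>x y. x < r (Suc k) \<Longrightarrow> y < r (Suc k) \<Longrightarrow>
     (\<Sum>i<r k. \<Sum>j<n (Suc k). K x i j * entry (entry X (Suc k)) (i, j, y)) = (if x = y then 1 else 0)"
    unfolding left_unfolding_full_rank_iff by auto
  show ?thesis
  proof (rule that)
    fix x y assume "x < r (Suc k)" "y < r (Suc k)"
    then show "(\<Sum>i<n (Suc k). mprod {..<r k} (\<lambda>x a. K x a i) (core_slice X (Suc k) i) x y) = (if x = y then 1 else 0)"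
      unfolding mprod_def core_slice_def using K by (subst sum.swap) simp
  qed
qed

lemma core_right_inverse:
  assumes "X \<in> total_space d n r" "Suc k \<le> d"
  obtains K where "\<And>x y. x < r k \<Longrightarrow> y < r k \<Longrightarrow>
     (\<Sum>i<n (Suc k). mprod {..<r (Suc k)} (core_slice X (Suc k) i) (K i) x y) = (if x = y then 1 else 0)"
proof -
  have "Suc k \<in> {1..d}" using assms by simp
  then have "vec_space.rank (r (Suc k - 1))
     (right_unfolding (r (Suc k - 1)) (n (Suc k)) (r (Suc k)) (entry X (Suc k))) = r (Suc k - 1)"
    using assms(1) unfolding total_space_def by blast
  then obtain K where K: "\<And>x y. x < r k \<Longrightarrow> y < r k \<Longrightarrow>
     (\<Sum>i<n (Suc k). \<Sum>j<r (Suc k). entry (entry X (Suc k)) (x, i, j) * K i j y) = (if x = y then 1 else 0)"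
    unfolding right_unfolding_full_rank_iff by auto
  then show ?thesis by (intro that[of K]) (simp add: mprod_def core_slice_def)
qed

text \<open>
  \<open>X\<^sub>\<le>\<^sub>k\<^sub>+\<^sub>1\<close> is \<open>X\<^sub>\<le>\<^sub>k\<close> followed by the left unfolding of the core \<open>k + 1\<close>. Its left inverse therefore applies
  first that of \<open>X\<^sub>\<le>\<^sub>k\<close> to all indices but the last, then that of the unfolding.
\<close>

lemma left_interface_inverse:
  assumes X: "X \<in> total_space d n r"
  shows "k \<le> d \<Longrightarrow> \<exists>L. is_one (r k) (mprod (index_box n 0 k) L (left_part X))"
proof (induction k)
  case 0
  then show ?case using r_0 by (intro exI[of _ "\<lambda>_ _. 1"]) (simp add: is_one_def mprod_def left_part_def)
next
  case (Suc k)
  then obtain L where L: "is_one (r k) (mprod (index_box n 0 k) L (left_part X))" by auto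
  obtain K where K: "\<And>x y. x < r (Suc k) \<Longrightarrow> y < r (Suc k) \<Longrightarrow>
     (\<Sum>i<n (Suc k). mprod {..<r k} (\<lambda>x a. K x a i) (core_slice X (Suc k) i) x y) = (if x = y then 1 else 0)"
    using core_left_inverse[OF X Suc.prems] by blast
  define L' where "L' x q = mprod {..<r k} (\<lambda>x a. K x a (last q)) L x (butlast q)" for x q
  have "mprod (index_box n 0 (Suc k)) L' (left_part X) x y = (if x = y then 1 else 0)"
    if xy: "x < r (Suc k)" "y < r (Suc k)" for x y
  proof -
    have "mprod (index_box n 0 (Suc k)) L' (left_part X) x y =
       (\<Sum>p\<in>index_box n 0 k. \<Sum>i<n (Suc k). L' x (p @ [i]) * left_part X (p @ [i]) y)"
      by (simp add: mprod_def sum_index_box_snoc)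
    also have "\<dots> = (\<Sum>i<n (Suc k). \<Sum>p\<in>index_box n 0 k. L' x (p @ [i]) * left_part X (p @ [i]) y)"
      by (rule sum.swap)
    also have "\<dots> = (\<Sum>i<n (Suc k). mprod (index_box n 0 k) (mprod {..<r k} (\<lambda>x a. K x a i) L)
        (mprod {..<r k} (left_part X) (core_slice X (Suc k) i)) x y)"
      using xy unfolding mprod_def[of "index_box n 0 k"]
      by (intro sum.cong refl) (simp add: L'_def left_part_snoc index_box_def)
    also have "\<dots> = (\<Sum>i<n (Suc k). mprod {..<r k} (\<lambda>x a. K x a i)
        (mprod {..<r k} (mprod (index_box n 0 k) L (left_part X)) (core_slice X (Suc k) i)) x y)"
      by (simp only: mprod_assoc)
    also have "\<dots> = (\<Sum>i<n (Suc k). mprod {..<r k} (\<lambda>x a. K x a i) (core_slice X (Suc k) i) x y)"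
      by (intro sum.cong refl mprod_cong mprod_one_left[OF L]) simp
    finally show ?thesis using K xy by simp
  qed
  then show ?case unfolding is_one_def by blast
qed

text \<open>The mirror image of the preceding lemma, going down from the right end.\<close>

lemma right_interface_inverse:
  assumes X: "X \<in> total_space d n r" and "k \<le> d"
  shows "\<exists>R. is_one (r k) (mprod (index_box n k (d - k)) (right_part X k) R)"
  using assms(2)
proof (induction k rule: inc_induct)
  case base
  then show ?case using r_d by (intro exI[of _ "\<lambda>_ _. 1"]) (simp add: is_one_def mprod_def right_part_def)
next
  case (step k)
  then obtain R where R: "is_one (r (Suc k)) (mprod (index_box n (Suc k) (d - Suc k)) (right_part X (Suc k)) R)" by auto
  obtain K where K: "\<And>x y. x < r k \<Longrightarrow> y < r k \<Longrightarrow>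
     (\<Sum>i<n (Suc k). mprod {..<r (Suc k)} (core_slice X (Suc k) i) (K i) x y) = (if x = y then 1 else 0)"
    using core_right_inverse[OF X, of k] step by auto
  define R' where "R' q y = mprod {..<r (Suc k)} R (K (hd q)) (tl q) y" for q y
  have dk: "d - k = Suc (d - Suc k)" using step by simp
  have "mprod (index_box n k (d - k)) (right_part X k) R' x y = (if x = y then 1 else 0)"
    if xy: "x < r k" "y < r k" for x y
  proof -
    have "mprod (index_box n k (d - k)) (right_part X k) R' x y =
       (\<Sum>i<n (Suc k). \<Sum>s\<in>index_box n (Suc k) (d - Suc k). right_part X k x (i # s) * R' (i # s) y)"
      by (simp add: mprod_def sum_index_box_Suc dk)
    also have "\<dots> = (\<Sum>i<n (Suc k). mprod (index_box n (Suc k) (d - Suc k))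
        (mprod {..<r (Suc k)} (core_slice X (Suc k) i) (right_part X (Suc k))) (mprod {..<r (Suc k)} R (K i)) x y)"
      unfolding mprod_def[of "index_box n (Suc k) (d - Suc k)"] by (simp add: R'_def right_part_Cons)
    also have "\<dots> = (\<Sum>i<n (Suc k). mprod {..<r (Suc k)} (core_slice X (Suc k) i)
        (mprod {..<r (Suc k)} (mprod (index_box n (Suc k) (d - Suc k)) (right_part X (Suc k)) R) (K i)) x y)"
      by (simp only: mprod_assoc)
    also have "\<dots> = (\<Sum>i<n (Suc k). mprod {..<r (Suc k)} (core_slice X (Suc k) i) (K i) x y)"
      by (intro sum.cong refl mprod_cong mprod_one_left[OF R]) simp
    finally show ?thesis using K xy by simp
  qed
  then show ?case unfolding is_one_def by blast
qed

section \<open>The space of cores\<close>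

lemma core_spaceD:
  assumes "X \<in> E" "entry (entry X k) (x, i, y) \<noteq> 0"
  shows "1 \<le> k" "k \<le> d" "x < r (k - 1)" "i < n k" "y < r k"
proof -
  have "entry X k \<noteq> 0" using assms(2) by auto
  then have k: "k \<in> {1..d}" using assms(1) unfolding core_space_def by (auto simp: in_keys_iff)
  then show "1 \<le> k" "k \<le> d" by auto
  have "(x, i, y) \<in> Poly_Mapping.keys (entry X k)" using assms(2) by (simp add: in_keys_iff)
  then have "(x, i, y) \<in> {..<r (k - 1)} \<times> {..<n k} \<times> {..<r k}"
    using assms(1) k unfolding core_space_def by blast
  then show "x < r (k - 1)" "i < n k" "y < r k" by auto
qed

lemma core_spaceI:
  assumes "\<And>k x i y. entry (entry X k) (x, i, y) \<noteq> 0 \<Longrightarrow> 1 \<le> k \<and> k \<le> d \<and> x < r (k - 1) \<and> i < n k \<and> y < r k"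
  shows "X \<in> E"
proof -
  have "k \<in> {1..d}" if "k \<in> Poly_Mapping.keys X" for k
  proof -
    have "entry X k \<noteq> 0" using that by (simp add: in_keys_iff)
    then obtain q where "entry (entry X k) q \<noteq> 0" by (metis poly_mapping_eqI lookup_zero)
    then show ?thesis using assms by (cases q) auto
  qed
  then show ?thesis using assms unfolding core_space_def by (fastforce simp: in_keys_iff)
qed

lemma core_space_eqI:
  assumes "X \<in> E" "Y \<in> E"
    and "\<And>k x i y. k < d \<Longrightarrow> x < r k \<Longrightarrow> i < n (Suc k) \<Longrightarrow> y < r (Suc k) \<Longrightarrow>
      core_slice X (Suc k) i x y = core_slice Y (Suc k) i x y"
  shows "X = Y"
proof (intro poly_mapping_eqI)
  fix k and q :: "nat \<times> nat \<times> nat"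
  obtain x i y where q: "q = (x, i, y)" by (cases q)
  show "entry (entry X k) q = entry (entry Y k) q"
  proof (cases "1 \<le> k \<and> k \<le> d \<and> x < r (k - 1) \<and> i < n k \<and> y < r k")
    case True
    then have "k - 1 < d" "Suc (k - 1) = k" by auto
    then show ?thesis using True assms(3)[of "k - 1" x i y] by (simp add: core_slice_def q)
  next
    case False
    then show ?thesis using core_spaceD[OF assms(1)] core_spaceD[OF assms(2)] unfolding q by metis
  qed
qed

lemma subspace_core_space: "Real_Vector_Spaces.subspace E"
  unfolding real_vector.subspace_def
proof (intro conjI ballI allI)
  show "0 \<in> E" by (rule core_spaceI) simp
next
  fix X Y assume XY: "X \<in> E" "Y \<in> E"
  show "X + Y \<in> E"
  proof (rule core_spaceI)
    fix k x i y assume "entry (entry (X + Y) k) (x, i, y) \<noteq> 0"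
    then have "entry (entry X k) (x, i, y) \<noteq> 0 \<or> entry (entry Y k) (x, i, y) \<noteq> 0" by (auto simp: lookup_add)
    then show "1 \<le> k \<and> k \<le> d \<and> x < r (k - 1) \<and> i < n k \<and> y < r k"
      using core_spaceD[OF XY(1)] core_spaceD[OF XY(2)] by metis
  qed
next
  fix c :: real and X assume X: "X \<in> E"
  show "c *\<^sub>R X \<in> E"
  proof (rule core_spaceI)
    fix k x i y assume "entry (entry (c *\<^sub>R X) k) (x, i, y) \<noteq> 0"
    then have "entry (entry X k) (x, i, y) \<noteq> 0" by auto
    then show "1 \<le> k \<and> k \<le> d \<and> x < r (k - 1) \<and> i < n k \<and> y < r k"
      using core_spaceD[OF X] by metis
  qed
qed

lemma core_space_basis:
  obtains J and b :: "nat \<times> nat \<times> nat \<times> nat \<Rightarrow> cores" where "finite J" "b ` J \<subseteq> E"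
    "\<And>X. X \<in> E \<Longrightarrow> X = (\<Sum>j\<in>J. entry (entry X (fst j)) (snd j) *\<^sub>R b j)"
proof -
  define J where "J = (\<Union>k\<in>{1..d}. {k} \<times> {..<r (k - 1)} \<times> {..<n k} \<times> {..<r k})"
  define b :: "nat \<times> nat \<times> nat \<times> nat \<Rightarrow> cores" where
    "b = (\<lambda>(k, q). Poly_Mapping.single k (Poly_Mapping.single q 1))"
  have fin: "finite J" by (simp add: J_def)
  have "X = (\<Sum>j\<in>J. entry (entry X (fst j)) (snd j) *\<^sub>R b j)" if X: "X \<in> E" for X
  proof (intro poly_mapping_eqI)
    fix k and q :: "nat \<times> nat \<times> nat"
    have "entry (entry (\<Sum>j\<in>J. entry (entry X (fst j)) (snd j) *\<^sub>R b j) k) q =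
        (\<Sum>j\<in>J. if j = (k, q) then entry (entry X k) q else 0)"
      unfolding lookup_sum
      by (intro sum.cong refl) (auto simp: b_def lookup_single when_def split: if_splits)
    also have "\<dots> = (if (k, q) \<in> J then entry (entry X k) q else 0)"
      using fin by simp
    also have "\<dots> = entry (entry X k) q"
    proof (cases "(k, q) \<in> J")
      case False
      obtain x i y where q: "q = (x, i, y)" by (cases q)
      have "entry (entry X k) q = 0"
        using False core_spaceD[OF X, of k x i y] unfolding q J_def by auto
      then show ?thesis by simp
    qed simp
    finally show "entry (entry X k) q = entry (entry (\<Sum>j\<in>J. entry (entry X (fst j)) (snd j) *\<^sub>R b j) k) q"
      by simp
  qed
  moreover have "b j \<in> E" if "j \<in> J" for j
    using that by (intro core_spaceI) (auto simp: b_def J_def lookup_single when_def split: if_splits)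
  ultimately show ?thesis using fin by (intro that[of J b]) auto
qed

text \<open>
  Replacing one core by \<open>\<zeta>\<close> leaves the interface matrices on both sides of it unchanged, so the
  resulting tensor is linear in \<open>\<zeta>\<close> and can be inverted for \<open>\<zeta>\<close>.
\<close>

lemma entry_phi_update:
  assumes "j < d"
  shows "entry (\<phi> (Poly_Mapping.update (Suc j) \<zeta> X)) is = (if is \<in> index_box n 0 d then
     mprod {..<r j} (left_part X) (mprod {..<r (Suc j)} (\<lambda>a b. entry \<zeta> (a, is ! j, b)) (right_part X (Suc j)))
       (take j is) (drop (Suc j) is) else 0)"
proof (cases "is \<in> index_box n 0 d")
  case True
  let ?X = "Poly_Mapping.update (Suc j) \<zeta> X"
  have len: "length is = d" using True by (simp add: index_box_def)
  have is_eq: "is = take j is @ is ! j # drop (Suc j) is" using assms len by (simp add: id_take_nth_drop)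
  have l: "left_part ?X (take j is) = left_part X (take j is)"
    unfolding left_part_def using assms len
    by (intro ext, subst chain_cong[of 0 "take j is" ?X X]) (auto simp: lookup_update)
  have rr: "right_part ?X (Suc j) c (drop (Suc j) is) = right_part X (Suc j) c (drop (Suc j) is)" for c
    unfolding right_part_def using assms len
    by (subst chain_cong[of "Suc j" "drop (Suc j) is" ?X X]) (auto simp: lookup_update)
  have s: "core_slice ?X (Suc j) (is ! j) = (\<lambda>a b. entry \<zeta> (a, is ! j, b))"
    by (simp add: core_slice_def lookup_update)
  have "entry (\<phi> ?X) is = C ?X 0 (take j is @ is ! j # drop (Suc j) is) 0 0"
    using True by (simp add: entry_tt_map flip: is_eq)
  also have "\<dots> = mprod {..<r j} (left_part ?X) (right_part ?X j) (take j is) (is ! j # drop (Suc j) is)"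
    using assms len by (intro chain_split) simp
  also have "\<dots> = mprod {..<r j} (left_part X) (mprod {..<r (Suc j)} (\<lambda>a b. entry \<zeta> (a, is ! j, b)) (right_part X (Suc j)))
       (take j is) (drop (Suc j) is)"
    using l by (simp add: mprod_def[of "{..<r j}"] right_part_Cons s) (simp add: mprod_def rr)
  finally show ?thesis using True by simp
qed (simp add: entry_tt_map)

lemma index_box_middle:
  assumes "p \<in> index_box n 0 j" "i < n (Suc j)" "s \<in> index_box n (Suc j) (d - Suc j)" "j < d"
  shows "p @ i # s \<in> index_box n 0 d"
proof -
  have "i # s \<in> index_box n j (Suc (d - Suc j))" using assms by (auto simp: index_box_Suc)
  then have "p @ i # s \<in> index_box n 0 (j + Suc (d - Suc j))" using assms index_box_append[of p n 0 j "i # s" "Suc (d - Suc j)"] by simp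
  moreover have "j + Suc (d - Suc j) = d" using assms by simp
  ultimately show ?thesis by simp
qed

text \<open>
  Contract with a left inverse of the left and a right inverse of the right interface matrix. This
  is what makes the metric definite.
\<close>

lemma phi_update_injective:
  assumes X: "X \<in> total_space d n r" and j: "j < d"
    and 0: "\<phi> (Poly_Mapping.update (Suc j) \<zeta> X) = 0"
    and xiy: "x < r j" "i < n (Suc j)" "y < r (Suc j)"
  shows "entry \<zeta> (x, i, y) = 0"
proof -
  obtain L where L: "is_one (r j) (mprod (index_box n 0 j) L (left_part X))"
    using left_interface_inverse[OF X, of j] j by auto
  obtain R where R: "is_one (r (Suc j)) (mprod (index_box n (Suc j) (d - Suc j)) (right_part X (Suc j)) R)"
    using right_interface_inverse[OF X, of "Suc j"] j by auto
  let ?Z = "\<lambda>a b. entry \<zeta> (a, i, b)"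
  let ?T = "mprod {..<r j} (left_part X) (mprod {..<r (Suc j)} ?Z (right_part X (Suc j)))"
  have T0: "?T p s = 0" if "p \<in> index_box n 0 j" "s \<in> index_box n (Suc j) (d - Suc j)" for p s
  proof -
    have "length p = j" using that by (simp add: index_box_def)
    then have "?T p s = entry (\<phi> (Poly_Mapping.update (Suc j) \<zeta> X)) (p @ i # s)"
      using index_box_middle[OF that(1) xiy(2) that(2) j] by (simp add: entry_phi_update[OF j] nth_append)
    then show ?thesis by (simp add: 0)
  qed
  have "mprod (index_box n (Suc j) (d - Suc j)) ?T R p y = 0" if "p \<in> index_box n 0 j" for p
    using that by (intro mprod_zero_left T0)
  then have "mprod (index_box n 0 j) L (mprod (index_box n (Suc j) (d - Suc j)) ?T R) x y = 0"
    by (rule mprod_zero_right)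
  then have "mprod {..<r j} (mprod (index_box n 0 j) L (left_part X))
       (mprod {..<r (Suc j)} ?Z (mprod (index_box n (Suc j) (d - Suc j)) (right_part X (Suc j)) R)) x y = 0"
    unfolding mprod_sandwich .
  then show ?thesis
    unfolding mprod_one_left[OF L xiy(1)] mprod_one_right[OF R xiy(3)] .
qed

end

section \<open>The preconditioned metric\<close>

text \<open>One Gram--Schmidt step per generator, for a bilinear form that is definite only on the span.\<close>

lemma orthogonal_projection_onto_span:
  fixes g :: "'a::real_vector \<Rightarrow> 'a \<Rightarrow> real"
  assumes "finite B" and lin: "\<And>x. linear (g x)" and sym: "\<And>x y. g x y = g y x"
    and pos: "\<And>x. x \<in> Real_Vector_Spaces.span B \<Longrightarrow> g x x = 0 \<Longrightarrow> x = 0"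
  shows "\<exists>y\<in>Real_Vector_Spaces.span B. \<forall>z\<in>Real_Vector_Spaces.span B. g (x - y) z = 0"
  using assms(1) pos
proof (induction B arbitrary: x rule: finite_induct)
  case empty
  then show ?case using linear_0[OF lin] by simp
next
  case (insert b B)
  let ?span = "Real_Vector_Spaces.span"
  note radd = linear_add[OF lin] and rscale = linear_scale[OF lin] and rdiff = linear_diff[OF lin]
  have ldiff: "g (u - v) w = g u w - g v w" for u v w
    using rdiff[of w u v] by (simp add: sym)
  have lscale: "g (c *\<^sub>R u) w = c * g u w" for c u w
    using rscale[of w c u] by (simp add: sym)
  have sub: "?span B \<subseteq> ?span (insert b B)" by (intro real_vector.span_mono) auto
  have IH: "\<exists>y\<in>?span B. \<forall>z\<in>?span B. g (x - y) z = 0" for x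
    using insert.IH insert.prems sub by blast
  obtain y0 where y0: "y0 \<in> ?span B" "\<And>z. z \<in> ?span B \<Longrightarrow> g (x - y0) z = 0" using IH by blast
  obtain b0 where b0: "b0 \<in> ?span B" "\<And>z. z \<in> ?span B \<Longrightarrow> g (b - b0) z = 0" using IH by blast
  define e where "e = b - b0"
  have e: "e \<in> ?span (insert b B)"
    unfolding e_def using b0 sub real_vector.span_base[of b "insert b B"]
    by (intro real_vector.span_diff) auto
  \<comment> \<open>If \<open>e = 0\<close> the quotient is \<open>0\<close>, which is the right coefficient in that case too.\<close>
  define c where "c = g (x - y0) e / g e e"
  have ce: "g (x - y0) e = c * g e e"
  proof (cases "g e e = 0")
    case True
    then have "e = 0" using insert.prems[OF e] by blast
    then show ?thesis using linear_0[OF lin] by simp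
  qed (simp add: c_def)
  show ?case
  proof (intro bexI ballI)
    show "y0 + c *\<^sub>R e \<in> ?span (insert b B)"
      using y0 sub e by (intro real_vector.span_add real_vector.span_scale) auto
    fix z assume "z \<in> ?span (insert b B)"
    then obtain k where k: "z - k *\<^sub>R b \<in> ?span B" using real_vector.span_breakdown_eq by blast
    define w where "w = (z - k *\<^sub>R b) + k *\<^sub>R b0"
    have w: "w \<in> ?span B" unfolding w_def using k b0 by (intro real_vector.span_add real_vector.span_scale)
    have "z = k *\<^sub>R e + w" by (simp add: e_def w_def algebra_simps)
    moreover have "g (x - (y0 + c *\<^sub>R e)) u = g (x - y0) u - c * g e u" for u
      using ldiff[of "x - y0" "c *\<^sub>R e" u] by (simp add: lscale algebra_simps)
    ultimately show "g (x - (y0 + c *\<^sub>R e)) z = 0"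
      using y0(2)[OF w] b0(2)[OF w] ce by (simp add: radd rscale flip: e_def)
  qed
qed

text \<open>
  The Frobenius product is defined by a sum over the support of its first argument. Over a common
  index set it becomes visibly bilinear and symmetric.
\<close>

lemma frobenius_eq_sum:
  assumes "finite I" "Poly_Mapping.keys S \<subseteq> I"
  shows "frobenius S T = (\<Sum>i\<in>I. entry S i * entry T i)"
  unfolding frobenius_def using assms
  by (intro sum.mono_neutral_left) (auto simp: in_keys_iff)

context tt_format begin

lemma linear_phi_update:
  assumes "k \<in> {1..d}"
  shows "linear (\<lambda>Z. \<phi> (Poly_Mapping.update k (entry Z k) X))"
proof -
  obtain j where j: "k = Suc j" "j < d" using assms by (cases k) auto
  show ?thesis unfolding j(1)
    by (intro linearI poly_mapping_eqI)
      (simp_all add: entry_phi_update[OF j(2)] lookup_add mprod_add_left mprod_add_right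
        mprod_scale_left mprod_scale_right)
qed

lemma linear_dphi: "linear (d\<phi> X)"
  unfolding d\<phi>_def[abs_def] by (intro linear_compose_sum ballI linear_phi_update)

lemma keys_tt_map: "Poly_Mapping.keys (\<phi> X) \<subseteq> index_box n 0 d"
  by (auto simp: in_keys_iff entry_tt_map split: if_splits)

lemma frobenius_tt_map: "frobenius (\<phi> X) T = (\<Sum>is\<in>index_box n 0 d. entry (\<phi> X) is * entry T is)"
  by (intro frobenius_eq_sum keys_tt_map) simp

abbreviation "g \<equiv> precond_metric d n r"

lemma metric_sym: "g X Z W = g X W Z"
  by (simp add: precond_metric_def frobenius_tt_map mult.commute)

lemma linear_metric: "linear (g X Z)"
proof -
  have "linear (\<lambda>W. frobenius (\<phi> Y) (\<phi> (Poly_Mapping.update k (entry W k) X)))" if "k \<in> {1..d}" for k Y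
    unfolding frobenius_tt_map
    by (intro linearI; simp only: linear_add[OF linear_phi_update[OF that]] linear_scale[OF linear_phi_update[OF that]])
      (simp_all add: lookup_add distrib_left sum.distrib sum_distrib_left mult.left_commute)
  then show ?thesis unfolding precond_metric_def[abs_def] by (intro linear_compose_sum ballI)
qed

lemma metric_pos:
  assumes X: "X \<in> total_space d n r" and Z: "Z \<in> E" and 0: "g X Z Z = 0"
  shows "Z = 0"
proof (rule core_space_eqI[OF Z])
  show "0 \<in> E" using subspace_core_space by (rule real_vector.subspace_0)
  fix k x i y assume k: "k < d" and xiy: "x < r k" "i < n (Suc k)" "y < r (Suc k)"
  let ?T = "\<lambda>k. \<phi> (Poly_Mapping.update k (entry Z k) X)"
  have nn: "frobenius (?T j) (?T j) \<ge> 0" for j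
    unfolding frobenius_tt_map by (intro sum_nonneg) simp
  have "\<forall>j\<in>{1..d}. frobenius (?T j) (?T j) = 0"
    using 0 unfolding precond_metric_def by (subst (asm) sum_nonneg_eq_0_iff) (auto simp: nn)
  then have "frobenius (?T (Suc k)) (?T (Suc k)) = 0" using k by simp
  then have "\<forall>is\<in>index_box n 0 d. entry (?T (Suc k)) is = 0"
    unfolding frobenius_tt_map by (subst (asm) sum_nonneg_eq_0_iff) auto
  then have "?T (Suc k) = 0"
    by (intro poly_mapping_eqI) (metis entry_tt_map lookup_zero)
  then show "core_slice Z (Suc k) i x y = core_slice 0 (Suc k) i x y"
    using phi_update_injective[OF X k _ xiy] by (simp add: core_slice_def)
qed

section \<open>The vertical space is the kernel of the derivative\<close>

definition vertical_vector :: "cores \<Rightarrow> (nat \<Rightarrow> real mat) \<Rightarrow> cores" where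
  "vertical_vector X D = on_support {1..d} (\<lambda>k.
        (if 1 < k then - (entry X k \<times>\<^sub>1 D (k - 1)) else 0) +
        (if k < d then entry X k \<times>\<^sub>3 transpose_mat (D k) else 0))"

text \<open>
  The matrix of a gauge direction at every cut, with \<open>0\<close> at the two outer cuts, where there is no gauge
  freedom. With this convention the formula for a vertical vector is the same for all cores.
\<close>

definition gauge_at :: "(nat \<Rightarrow> real mat) \<Rightarrow> nat \<Rightarrow> nat \<Rightarrow> nat \<Rightarrow> real" where
  "gauge_at D k = (\<lambda>x y. if 0 < k \<and> k < d then D k $$ (x, y) else 0)"

lemma entry_vertical_vector:
  assumes D: "\<forall>k\<in>{1..<d}. D k \<in> carrier_mat (r k) (r k)" and k: "k < d"
  shows "entry (entry (vertical_vector X D) (Suc k)) (x, i, y) =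
    (if x < r k then - mprod {..<r k} (gauge_at D k) (core_slice X (Suc k) i) x y else 0) +
    (if y < r (Suc k) then mprod {..<r (Suc k)} (core_slice X (Suc k) i) (gauge_at D (Suc k)) x y else 0)"
proof -
  have 1: "entry ((if 1 < Suc k then - (entry X (Suc k) \<times>\<^sub>1 D (Suc k - 1)) else 0)) (x, i, y) =
      (if x < r k then - mprod {..<r k} (gauge_at D k) (core_slice X (Suc k) i) x y else 0)"
  proof (cases "0 < k")
    case True
    then have "D k \<in> carrier_mat (r k) (r k)" using D k by simp
    then show ?thesis using True k
      by (simp add: entry_mode1_prod mprod_def gauge_at_def core_slice_def mult.commute)
  qed (simp add: mprod_def gauge_at_def)
  have 2: "entry ((if Suc k < d then entry X (Suc k) \<times>\<^sub>3 transpose_mat (D (Suc k)) else 0)) (x, i, y) =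
      (if y < r (Suc k) then mprod {..<r (Suc k)} (core_slice X (Suc k) i) (gauge_at D (Suc k)) x y else 0)"
  proof (cases "Suc k < d")
    case True
    then have "D (Suc k) \<in> carrier_mat (r (Suc k)) (r (Suc k))" using D by simp
    then show ?thesis using True
      by (auto simp: entry_mode3_prod mprod_def gauge_at_def core_slice_def intro!: sum.cong)
  qed (simp add: mprod_def gauge_at_def)
  show ?thesis
    using k unfolding vertical_vector_def by (simp only: entry_on_support[OF finite_atLeastAtMost]) (simp add: lookup_add 1[simplified] 2)
qed

lemma vertical_vector_in_core_space:
  assumes X: "X \<in> E" and D: "\<forall>k\<in>{1..<d}. D k \<in> carrier_mat (r k) (r k)"
  shows "vertical_vector X D \<in> E"
proof (rule core_spaceI)
  fix k x i y assume nz: "entry (entry (vertical_vector X D) k) (x, i, y) \<noteq> 0"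
  have "k \<in> {1..d}"
    using nz unfolding vertical_vector_def by (simp only: entry_on_support[OF finite_atLeastAtMost]) (auto split: if_splits)
  then obtain j where j: "k = Suc j" "j < d" by (cases k) auto
  have "x < r j \<and> mprod {..<r j} (gauge_at D j) (core_slice X (Suc j) i) x y \<noteq> 0 \<or>
      y < r (Suc j) \<and> mprod {..<r (Suc j)} (core_slice X (Suc j) i) (gauge_at D (Suc j)) x y \<noteq> 0"
    using nz unfolding j(1) entry_vertical_vector[OF D j(2)] by (auto split: if_splits)
  then show "1 \<le> k \<and> k \<le> d \<and> x < r (k - 1) \<and> i < n k \<and> y < r k"
  proof (elim disjE)
    assume 1: "x < r j \<and> mprod {..<r j} (gauge_at D j) (core_slice X (Suc j) i) x y \<noteq> 0"
    then obtain a where "core_slice X (Suc j) i a y \<noteq> 0"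
      using mprod_zero_right[of "{..<r j}" "core_slice X (Suc j) i" y "gauge_at D j" x] by blast
    then show ?thesis using core_spaceD[OF X, of "Suc j" a i y] 1 j by (simp add: core_slice_def)
  next
    assume 2: "y < r (Suc j) \<and> mprod {..<r (Suc j)} (core_slice X (Suc j) i) (gauge_at D (Suc j)) x y \<noteq> 0"
    then obtain b where "core_slice X (Suc j) i x b \<noteq> 0"
      using mprod_zero_left[of "{..<r (Suc j)}" "core_slice X (Suc j) i" x "gauge_at D (Suc j)" y] by blast
    then show ?thesis using core_spaceD[OF X, of "Suc j" x i b] 2 j by (simp add: core_slice_def)
  qed
qed

text \<open>
  The slices of a vertical vector are \<open>- D\<^sub>k X\<^sup>k\<^sup>+\<^sup>1(i) + X\<^sup>k\<^sup>+\<^sup>1(i) D\<^sub>k\<^sub>+\<^sub>1\<close>. In the derivative of a product of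
  slices the inner terms cancel, and only the gauge matrices at the two ends survive.
\<close>

lemma dchain_vertical_vector:
  assumes D: "\<forall>k\<in>{1..<d}. D k \<in> carrier_mat (r k) (r k)"
  shows "k + length s \<le> d \<Longrightarrow> x < r k \<Longrightarrow> y < r (k + length s) \<Longrightarrow>
    DC X (vertical_vector X D) k s x y = mprod {..<r (k + length s)} (C X k s) (gauge_at D (k + length s)) x y
      - mprod {..<r k} (gauge_at D k) (C X k s) x y"
proof (induction s arbitrary: k x)
  case Nil
  then show ?case
    by (simp add: mprod_id_left mprod_one_right[OF is_one_chain_Nil[of "r k" r X k, simplified]])
next
  case (Cons i s)
  let ?e = "k + length (i # s)"
  let ?S = "core_slice X (Suc k) i" and ?C = "C X (Suc k) s" and ?M = "{..<r (Suc k)}"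
  have k: "k < d" using Cons.prems by simp
  have "DC X (vertical_vector X D) k (i # s) x y =
      mprod ?M (core_slice (vertical_vector X D) (Suc k) i) ?C x y + mprod ?M ?S (DC X (vertical_vector X D) (Suc k) s) x y"
    by simp
  also have "mprod ?M (core_slice (vertical_vector X D) (Suc k) i) ?C x y =
      mprod ?M (\<lambda>a b. - mprod {..<r k} (gauge_at D k) ?S a b + mprod ?M ?S (gauge_at D (Suc k)) a b) ?C x y"
    using Cons.prems by (intro mprod_cong) (auto simp: core_slice_def entry_vertical_vector[OF D k])
  also have "mprod ?M ?S (DC X (vertical_vector X D) (Suc k) s) x y =
      mprod ?M ?S (\<lambda>a b. mprod {..<r ?e} ?C (gauge_at D ?e) a b + - mprod ?M (gauge_at D (Suc k)) ?C a b) x y"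
    using Cons.prems by (intro mprod_cong) (auto simp: Cons.IH)
  finally show ?case
    by (simp add: mprod_diff_left mprod_diff_right mprod_assoc)
qed

lemma dphi_vertical_vector:
  assumes D: "\<forall>k\<in>{1..<d}. D k \<in> carrier_mat (r k) (r k)"
  shows "d\<phi> X (vertical_vector X D) = 0"
proof (rule poly_mapping_eqI)
  fix "is"
  show "entry (d\<phi> X (vertical_vector X D)) is = entry 0 is"
  proof (cases "is \<in> index_box n 0 d")
    case True
    then have "length is = d" by (simp add: index_box_def)
    then have "DC X (vertical_vector X D) 0 is 0 0 = 0"
      using dchain_vertical_vector[OF D, of 0 "is" 0 0 X] r_0 r_d by (simp add: gauge_at_def mprod_def)
    then show ?thesis by (simp add: entry_d\<phi>)
  qed (simp add: entry_d\<phi>)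
qed

lemma vertical_space_eq:
  "vertical_space d r X = {vertical_vector X D | D. \<forall>k\<in>{1..<d}. D k \<in> carrier_mat (r k) (r k)}"
  by (simp add: vertical_space_def vertical_vector_def)

text \<open>
  Let \<open>a\<^sub>k = L\<^sub>k DX\<^sub>\<le>\<^sub>k[Z]\<close> and \<open>b\<^sub>k = DX\<^sub>>\<^sub>k[Z] R\<^sub>k\<close>. Contracting \<open>D\<phi>[Z] = 0\<close> at the cut \<open>k\<close> gives
  \<open>a\<^sub>k + b\<^sub>k = 0\<close>, and contracting it around the core \<open>k + 1\<close> gives \<open>a\<^sub>k X(i) + Z(i) + X(i) b\<^sub>k\<^sub>+\<^sub>1 = 0\<close> for the
  slices of that core. So \<open>Z(i) = - a\<^sub>k X(i) + X(i) a\<^sub>k\<^sub>+\<^sub>1\<close>, which is vertical with gauge matrices \<open>a\<^sub>k\<close>.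
\<close>

lemma kernel_dphi:
  assumes X: "X \<in> total_space d n r" and Z: "Z \<in> E" and ker: "d\<phi> X Z = 0"
  shows "Z \<in> vertical_space d r X"
proof -
  have XE: "X \<in> E" using X by (simp add: total_space_def)
  obtain L where L: "\<And>k. k \<le> d \<Longrightarrow> is_one (r k) (mprod (index_box n 0 k) (L k) (left_part X))"
    using left_interface_inverse[OF X] by metis
  obtain R where R: "\<And>k. k \<le> d \<Longrightarrow> is_one (r k) (mprod (index_box n k (d - k)) (right_part X k) (R k))"
    using right_interface_inverse[OF X] by metis
  define a where "a k = mprod (index_box n 0 k) (L k) (d_left_part X Z)" for k
  define b where "b k = mprod (index_box n k (d - k)) (d_right_part X Z k) (R k)" for k
  have DC0: "DC X Z 0 is 0 0 = 0" if "is \<in> index_box n 0 d" for "is"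
    using entry_d\<phi>[of X Z "is"] that by (simp add: ker)
  have ab: "a k x y + b k x y = 0" if "k \<le> d" "x < r k" "y < r k" for k x y
  proof -
    let ?T = "\<lambda>p s. mprod {..<r k} (d_left_part X Z) (right_part X k) p s + mprod {..<r k} (left_part X) (d_right_part X Z k) p s"
    have T: "?T p s = 0" if "p \<in> index_box n 0 k" "s \<in> index_box n k (d - k)" for p s
    proof -
      have len: "length p = k" using that by (simp add: index_box_def)
      have mem: "p @ s \<in> index_box n 0 d"
        using that index_box_append[of p n 0 k s "d - k"] \<open>k \<le> d\<close> by simp
      show ?thesis using DC0[OF mem] unfolding dchain_split[OF len] .
    qed
    have z: "mprod (index_box n k (d - k)) ?T (R k) p y = 0" if "p \<in> index_box n 0 k" for p
      using that by (intro mprod_zero_left T)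
    have "mprod (index_box n 0 k) (L k) (mprod (index_box n k (d - k)) ?T (R k)) x y = 0"
      by (rule mprod_zero_right) (rule z)
    then have "mprod {..<r k} (a k) (mprod (index_box n k (d - k)) (right_part X k) (R k)) x y +
        mprod {..<r k} (mprod (index_box n 0 k) (L k) (left_part X)) (b k) x y = 0"
      by (simp add: a_def b_def mprod_add_left mprod_add_right mprod_assoc)
    then show ?thesis
      unfolding mprod_one_right[OF R[OF that(1)] that(3)] mprod_one_left[OF L[OF that(1)] that(2)] .
  qed
  \<comment> \<open>At the ends the derivative of the empty product vanishes, as \<open>gauge_at\<close> requires.\<close>
  have a0: "a 0 x y = 0" for x y by (simp add: a_def mprod_def d_left_part_def)
  have bd: "b d x y = 0" for x y by (simp add: b_def mprod_def d_right_part_def)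
  have ad: "a d x y = 0" if "x < r d" "y < r d" for x y using ab[of d x y] that bd by simp
  have Zform: "core_slice Z (Suc k) i x y = - mprod {..<r k} (a k) (core_slice X (Suc k) i) x y
       + mprod {..<r (Suc k)} (core_slice X (Suc k) i) (a (Suc k)) x y"
    if k: "k < d" and xiy: "x < r k" "i < n (Suc k)" "y < r (Suc k)" for k x i y
  proof -
    let ?S = "core_slice X (Suc k) i" and ?SZ = "core_slice Z (Suc k) i" and ?M = "{..<r k}" and ?N = "{..<r (Suc k)}"
    let ?P = "index_box n 0 k" and ?Q = "index_box n (Suc k) (d - Suc k)"
    let ?T = "\<lambda>p s. mprod ?M (d_left_part X Z) (mprod ?N ?S (right_part X (Suc k))) p s +
        mprod ?M (left_part X) (\<lambda>c s. mprod ?N ?SZ (right_part X (Suc k)) c s + mprod ?N ?S (d_right_part X Z (Suc k)) c s) p s"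
    have T: "?T p s = 0" if "p \<in> ?P" "s \<in> ?Q" for p s
    proof -
      have "length p = k" using that by (simp add: index_box_def)
      from dchain_split[OF this, of X Z "i # s"] DC0[OF index_box_middle[OF that(1) xiy(2) that(2) k]]
      show ?thesis by (simp add: mprod_def[of ?M] right_part_Cons d_right_part_Cons)
    qed
    have z: "mprod ?Q ?T (R (Suc k)) p y = 0" if "p \<in> ?P" for p
      using that by (intro mprod_zero_left T)
    have "mprod ?P (L k) (mprod ?Q ?T (R (Suc k))) x y = 0"
      by (rule mprod_zero_right) (rule z)
    then have "mprod ?M (a k) (mprod ?N ?S (mprod ?Q (right_part X (Suc k)) (R (Suc k)))) x y +
        (mprod ?M (mprod ?P (L k) (left_part X)) (mprod ?N ?SZ (mprod ?Q (right_part X (Suc k)) (R (Suc k)))) x y +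
        mprod ?M (mprod ?P (L k) (left_part X)) (mprod ?N ?S (b (Suc k))) x y) = 0"
      by (simp add: a_def b_def mprod_add_left mprod_add_right mprod_assoc)
    moreover have Lk: "is_one (r k) (mprod ?P (L k) (left_part X))" using L k by simp
    moreover have Rk: "is_one (r (Suc k)) (mprod ?Q (right_part X (Suc k)) (R (Suc k)))" using R[of "Suc k"] k by simp
    moreover have "mprod ?M (a k) (mprod ?N ?S (mprod ?Q (right_part X (Suc k)) (R (Suc k)))) x y = mprod ?M (a k) ?S x y"
      by (intro mprod_cong refl mprod_one_right[OF Rk xiy(3)])
    ultimately have "mprod ?M (a k) ?S x y + (?SZ x y + mprod ?N ?S (b (Suc k)) x y) = 0"
      unfolding mprod_one_left[OF Lk xiy(1)] mprod_one_right[OF Rk xiy(3)] by simp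
    moreover have "mprod ?N ?S (b (Suc k)) x y = - mprod ?N ?S (a (Suc k)) x y"
    proof -
      have "mprod ?N ?S (b (Suc k)) x y = mprod ?N ?S (\<lambda>c y. - a (Suc k) c y) x y"
        using ab[of "Suc k" _ y] k xiy by (intro mprod_cong) (auto simp: eq_neg_iff_add_eq_0 add.commute)
      then show ?thesis by (simp add: mprod_minus_right)
    qed
    ultimately show ?thesis by simp
  qed
  define D where "D k = mat (r k) (r k) (\<lambda>(x, y). a k x y)" for k
  have D: "\<forall>k\<in>{1..<d}. D k \<in> carrier_mat (r k) (r k)" by (simp add: D_def)
  have gauge_at: "gauge_at D k x y = a k x y" if "k \<le> d" "x < r k" "y < r k" for k x y
    using that a0 ad by (cases "k = 0 \<or> k = d") (auto simp: gauge_at_def D_def)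
  have "Z = vertical_vector X D"
  proof (rule core_space_eqI[OF Z vertical_vector_in_core_space[OF XE D]])
    fix k x i y assume k: "k < d" and xiy: "x < r k" "i < n (Suc k)" "y < r (Suc k)"
    have "mprod {..<r k} (gauge_at D k) (core_slice X (Suc k) i) x y = mprod {..<r k} (a k) (core_slice X (Suc k) i) x y"
      using k xiy by (intro mprod_cong) (auto simp: gauge_at)
    moreover have "mprod {..<r (Suc k)} (core_slice X (Suc k) i) (gauge_at D (Suc k)) x y =
        mprod {..<r (Suc k)} (core_slice X (Suc k) i) (a (Suc k)) x y"
      using k xiy by (intro mprod_cong) (auto simp: gauge_at)
    ultimately show "core_slice Z (Suc k) i x y = core_slice (vertical_vector X D) (Suc k) i x y"
      using Zform[OF k xiy] xiy by (simp add: core_slice_def[of "vertical_vector X D"] entry_vertical_vector[OF D k])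
  qed
  then show ?thesis using D unfolding vertical_space_eq by blast
qed

end

section \<open>Differentials along curves\<close>

lemma bounded_linear_entry: "bounded_linear (\<lambda>x. entry x i)"
proof (rule bounded_linear_intro[where K = 1])
  fix x :: "'a \<Rightarrow>\<^sub>0 'b"
  have "norm (entry x i) \<le> (\<Sum>j\<in>Poly_Mapping.keys x. norm (entry x j))"
    by (cases "i \<in> Poly_Mapping.keys x") (auto intro!: member_le_sum sum_nonneg simp: in_keys_iff)
  then show "norm (entry x i) \<le> norm x * 1" by (simp add: norm_poly_mapping_def dist_poly_mapping_def)
qed (auto simp: lookup_add)

lemma has_vector_derivative_entry:
  assumes "(c has_vector_derivative v) F"
  shows "((\<lambda>t. entry (c t) i) has_vector_derivative entry v i) F"
  by (rule bounded_linear.has_vector_derivative[OF bounded_linear_entry assms])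

lemma has_derivative_along_curve:
  assumes f: "(f has_derivative f') (at x within M)"
    and "0 < \<epsilon>" "c ` {-\<epsilon><..<\<epsilon>} \<subseteq> M" "c 0 = x" "(c has_vector_derivative v) (at 0)"
  shows "((f \<circ> c) has_vector_derivative f' v) (at (0::real))"
proof -
  have at: "at (0::real) within {-\<epsilon><..<\<epsilon>} = at 0" using assms(2) by (intro at_within_open) auto
  have "((f \<circ> c) has_vector_derivative f' v) (at 0 within {-\<epsilon><..<\<epsilon>})"
    by (rule vector_derivative_diff_chain_within)
      (use assms has_derivative_subset[OF f assms(3)] in \<open>auto intro: has_vector_derivative_at_within\<close>)
  then show ?thesis by (simp only: at)
qed

text \<open>
  A derivative within a set is not unique, and \<open>differential\<close> picks an arbitrary one. On a tangent
  vector all of them agree, since their value is the velocity of the image of a curve.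
\<close>

lemma differential_tangent:
  assumes f: "(f has_derivative f') (at x within M)" and v: "v \<in> tangent_space M x"
  shows "differential M f x v = f' v"
proof -
  obtain \<epsilon> c where c: "0 < \<epsilon>" "c ` {-\<epsilon><..<\<epsilon>} \<subseteq> M" "c 0 = x" "(c has_vector_derivative v) (at (0::real))"
    using v unfolding tangent_space_def by blast
  have "(f has_derivative differential M f x) (at x within M)"
    unfolding differential_def using f by (intro frechet_derivative_works[THEN iffD1] differentiableI)
  from has_derivative_along_curve[OF this c] has_derivative_along_curve[OF f c]
  show ?thesis by (rule vector_derivative_unique_at)
qed

text \<open>
  The claim is stable under differentiation: a directional derivative of such a curve has the same
  shape, with the derivatives of the polynomials as coefficients.
\<close>

lemma Ck_on_polynomial_curve:
  fixes p :: "'i \<Rightarrow> real poly" and v :: "'i \<Rightarrow> 'a::real_normed_vector"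
  shows "Ck_on k (\<lambda>t. \<Sum>i\<in>I. poly (p i) t *\<^sub>R v i) U"
proof (induction k arbitrary: p)
  case 0
  show ?case by (auto intro!: continuous_intros)
next
  case (Suc k)
  have der: "((\<lambda>t. \<Sum>i\<in>I. poly (p i) t *\<^sub>R v i) has_derivative
      (\<lambda>h. \<Sum>i\<in>I. (poly (pderiv (p i)) t * h) *\<^sub>R v i)) (at t)" for t
    by (intro has_derivative_sum has_derivative_scaleR_left)
      (use poly_DERIV[of _ t] in \<open>simp add: has_field_derivative_def\<close>)
  have fd: "frechet_derivative (\<lambda>t. \<Sum>i\<in>I. poly (p i) t *\<^sub>R v i) (at t) h =
      (\<Sum>i\<in>I. poly (Polynomial.smult h (pderiv (p i))) t *\<^sub>R v i)" for t h
    unfolding frechet_derivative_at[OF der[of t], symmetric] by (simp add: mult.commute)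
  show ?case
    unfolding Ck_on.simps fd
    by (intro conjI ballI allI Suc.IH) (use der in \<open>auto simp: differentiable_def\<close>)
qed

lemma smooth_on_submanifold_has_derivative:
  assumes "smooth_on_submanifold f M" "x \<in> M"
  shows "(f has_derivative differential M f x) (at x within M)"
proof -
  have "\<exists>U h. x \<in> U \<and> smooth_on_open h U \<and> (\<forall>y\<in>U \<inter> M. h y = f y)"
    using assms(1)[unfolded smooth_on_submanifold_def] assms(2) by (rule bspec)
  then obtain U h where U: "x \<in> U" "smooth_on_open h U" "\<forall>y\<in>U \<inter> M. h y = f y"
    by (elim exE conjE) (rule that)
  have "open U" "Ck_on (Suc 0) h U" using U(2) by (simp_all only: smooth_on_open_def)
  then obtain h' where "(h has_derivative h') (at x)"
    using U(1) unfolding Ck_on.simps differentiable_def by blast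
  then have "(h has_derivative h') (at x within M)" by (rule has_derivative_at_withinI)
  then have "(f has_derivative h') (at x within M)"
  proof (rule has_derivative_transform_eventually)
    show "\<forall>\<^sub>F y in at x within M. h y = f y"
      unfolding eventually_at_topological using \<open>open U\<close> U(1,3) by blast
  qed (use U(1,3) assms(2) in auto)
  then show ?thesis
    unfolding differential_def by (intro frechet_derivative_works[THEN iffD1] differentiableI)
qed

context tt_format begin

section \<open>Horizontal vectors\<close>

abbreviation "\<M> \<equiv> total_space d n r"

lemma vertical_space_eq_kernel:
  assumes X: "X \<in> \<M>"
  shows "vertical_space d r X = {Z \<in> E. d\<phi> X Z = 0}"
proof -
  have "X \<in> E" using X by (simp add: total_space_def)
  then show ?thesis using kernel_dphi[OF X] vertical_vector_in_core_space dphi_vertical_vector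
    unfolding vertical_space_eq by blast
qed

abbreviation "\<H> \<equiv> horizontal_space d n r"

lemma subspace_horizontal: "Real_Vector_Spaces.subspace (\<H> X)"
proof -
  have l: "linear (\<lambda>\<xi>. g X \<xi> \<eta>)" for \<eta>
    using linear_metric[of X \<eta>] unfolding metric_sym[of X \<eta>] .
  show ?thesis
    unfolding horizontal_space_def real_vector.subspace_def
    using subspace_core_space
    by (auto simp: real_vector.subspace_def linear_0[OF l] linear_add[OF l] linear_scale[OF l])
qed

lemma dphi_inj_on_horizontal:
  assumes X: "X \<in> \<M>"
  shows "inj_on (d\<phi> X) (\<H> X)"
proof (rule inj_onI)
  fix Z W assume ZW: "Z \<in> \<H> X" "W \<in> \<H> X" "d\<phi> X Z = d\<phi> X W"
  have H: "Z - W \<in> \<H> X" using subspace_horizontal ZW by (intro real_vector.subspace_diff)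
  then have E: "Z - W \<in> E" by (simp add: horizontal_space_def)
  have "d\<phi> X (Z - W) = 0" using ZW by (simp add: linear_diff[OF linear_dphi])
  then have "Z - W \<in> vertical_space d r X" using E by (simp add: vertical_space_eq_kernel[OF X])
  then have "g X (Z - W) (Z - W) = 0" using H by (simp add: horizontal_space_def)
  then show "Z = W" using metric_pos[OF X E] by simp
qed

text \<open>
  Subtract from \<open>Z\<close> its orthogonal projection onto the vertical space, which lies in the kernel. The
  projection exists because the vertical space is finite-dimensional.
\<close>

lemma horizontal_lift:
  assumes X: "X \<in> \<M>" and Z: "Z \<in> E"
  shows "\<exists>W\<in>\<H> X. d\<phi> X W = d\<phi> X Z"
proof -
  let ?V = "vertical_space d r X" and ?span = "Real_Vector_Spaces.span"
  have V: "Real_Vector_Spaces.subspace ?V"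
    unfolding vertical_space_eq_kernel[OF X] using subspace_core_space
    by (auto simp: real_vector.subspace_def linear_0[OF linear_dphi] linear_add[OF linear_dphi]
        linear_scale[OF linear_dphi])
  obtain J b where J: "finite J" "b ` J \<subseteq> E" "\<And>X. X \<in> E \<Longrightarrow> X = (\<Sum>j\<in>J. entry (entry X (fst j)) (snd j) *\<^sub>R b j)"
    by (rule core_space_basis) (rule that)
  have VE: "?V \<subseteq> E" by (auto simp: vertical_space_eq_kernel[OF X])
  have Esp: "E \<subseteq> ?span (b ` J)"
  proof
    fix Y assume "Y \<in> E"
    then have "Y = (\<Sum>j\<in>J. entry (entry Y (fst j)) (snd j) *\<^sub>R b j)" by (rule J(3))
    also have "\<dots> \<in> ?span (b ` J)"
      by (intro real_vector.span_sum real_vector.span_scale real_vector.span_base) auto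
    finally show "Y \<in> ?span (b ` J)" .
  qed
  obtain B where B: "B \<subseteq> ?V" "\<not> Real_Vector_Spaces.dependent B" "?V \<subseteq> ?span B"
    by (rule real_vector.maximal_independent_subset[of ?V])
  have finB: "finite B"
    using real_vector.independent_span_bound[of "b ` J" B] B VE Esp J(1) by auto
  have spB: "?span B = ?V"
    using B V by (intro subset_antisym real_vector.span_minimal) auto
  obtain Y where Y: "Y \<in> ?V" "\<And>W. W \<in> ?V \<Longrightarrow> g X (Z - Y) W = 0"
    using orthogonal_projection_onto_span[OF finB linear_metric metric_sym, of X Z] metric_pos[OF X] VE
    unfolding spB by blast
  have "Z - Y \<in> E" using Z Y VE subspace_core_space real_vector.subspace_diff by blast
  then have "Z - Y \<in> \<H> X" using Y by (simp add: horizontal_space_def)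
  moreover have "d\<phi> X (Z - Y) = d\<phi> X Z"
    using Y(1) by (simp add: linear_diff[OF linear_dphi] vertical_space_eq_kernel[OF X])
  ultimately show ?thesis by blast
qed

lemma update_same: "Poly_Mapping.update k (entry X k) X = X"
  by (rule poly_mapping_eqI) (simp add: lookup_update)

lemma dphi_self: "d\<phi> X X = real d *\<^sub>R \<phi> X"
  by (simp add: d\<phi>_def update_same sum_constant_scaleR)

lemma metric_self: "g X X Z = frobenius (\<phi> X) (d\<phi> X Z)"
  unfolding precond_metric_def d\<phi>_def frobenius_tt_map update_same lookup_sum sum_distrib_left
  by (rule sum.swap)

text \<open>By \<open>metric_self\<close>, \<open>g(X, Z) = \<langle>\<phi>(X), D\<phi>[Z]\<rangle>\<close>, and \<open>D\<phi>\<close> vanishes on vertical vectors.\<close>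

lemma self_horizontal:
  assumes X: "X \<in> \<M>"
  shows "X \<in> \<H> X"
proof -
  have "X \<in> E" using X by (simp add: total_space_def)
  then show ?thesis
    by (simp add: horizontal_space_def metric_self vertical_space_eq_kernel[OF X] frobenius_tt_map)
qed

section \<open>The derivative of the TT map\<close>

lemma has_derivative_chain:
  "((\<lambda>Y. C Y k s a b) has_derivative (\<lambda>Z. DC X Z k s a b)) (at X)"
proof (induction s arbitrary: k a)
  case (Cons i s)
  have core_slice: "((\<lambda>Y. core_slice Y (Suc k) i a c) has_derivative (\<lambda>Z. core_slice Z (Suc k) i a c)) (at X)" for c
    unfolding core_slice_def
    by (intro bounded_linear_imp_has_derivative bounded_linear_compose[OF bounded_linear_entry] bounded_linear_entry)
  have "((\<lambda>Y. \<Sum>c<r (Suc k). core_slice Y (Suc k) i a c * C Y (Suc k) s c b) has_derivative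
     (\<lambda>Z. \<Sum>c<r (Suc k). core_slice X (Suc k) i a c * DC X Z (Suc k) s c b + core_slice Z (Suc k) i a c * C X (Suc k) s c b)) (at X)"
    by (intro has_derivative_sum has_derivative_mult core_slice Cons.IH)
  then show ?case by (simp add: mprod_def sum.distrib add.commute)
qed simp

lemma tensor_expansion:
  assumes "Poly_Mapping.keys T \<subseteq> index_box n 0 d"
  shows "T = (\<Sum>is\<in>index_box n 0 d. entry T is *\<^sub>R Poly_Mapping.single is (1::real))"
proof (rule poly_mapping_eqI)
  fix "is"
  have "entry (\<Sum>js\<in>index_box n 0 d. entry T js *\<^sub>R Poly_Mapping.single js (1::real)) is =
      (\<Sum>js\<in>index_box n 0 d. if js = is then entry T is else 0)"
    unfolding lookup_sum by (intro sum.cong refl) (simp add: lookup_single when_def)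
  also have "\<dots> = entry T is"
    using assms by (auto simp: in_keys_iff)
  finally show "entry T is = entry (\<Sum>js\<in>index_box n 0 d. entry T js *\<^sub>R Poly_Mapping.single js (1::real)) is"
    by simp
qed

lemma has_derivative_phi: "(\<phi> has_derivative d\<phi> X) (at X)"
proof -
  have phi: "\<phi> Y = (\<Sum>is\<in>index_box n 0 d. C Y 0 is 0 0 *\<^sub>R Poly_Mapping.single is 1)" for Y
    using tensor_expansion[OF keys_tt_map, of Y] by (simp add: entry_tt_map)
  have keys: "Poly_Mapping.keys (d\<phi> X Z) \<subseteq> index_box n 0 d" for Z
    by (auto simp: in_keys_iff entry_d\<phi> split: if_splits)
  have dphi: "d\<phi> X Z = (\<Sum>is\<in>index_box n 0 d. DC X Z 0 is 0 0 *\<^sub>R Poly_Mapping.single is 1)" for Z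
    using tensor_expansion[OF keys, of Z] by (simp add: entry_d\<phi>)
  show ?thesis unfolding phi[abs_def] dphi[abs_def]
    by (intro has_derivative_sum has_derivative_scaleR_left has_derivative_chain)
qed

end

section \<open>Lines in the total space\<close>

text \<open>
  Multiplying the moving matrix with a left inverse of the initial one gives a square matrix that is
  the identity at \<open>t = 0\<close>. It stays invertible for small \<open>t\<close>, and its inverse corrects the left inverse.
\<close>

lemma eventually_left_unfolding_full_rank:
  fixes Z W :: core
  assumes "vec_space.rank (a * b) (left_unfolding a b c Z) = c"
  shows "\<forall>\<^sub>F t in nhds (0::real). vec_space.rank (a * b) (left_unfolding a b c (Z + t *\<^sub>R W)) = c"
proof -
  let ?S = "{..<a} \<times> {..<b}"
  define M where "M t = (\<lambda>(i, j) y. entry (Z + t *\<^sub>R W) (i, j, y))" for t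
  obtain K where K: "\<And>x y. x < c \<Longrightarrow> y < c \<Longrightarrow>
      (\<Sum>i<a. \<Sum>j<b. K x i j * entry Z (i, j, y)) = (if x = y then 1 else 0)"
    using assms unfolding left_unfolding_full_rank_iff by blast
  define N where "N = (\<lambda>x (i, j). K x i j)"
  have diff: "(\<lambda>t. mprod ?S N (M t) x y) differentiable (at 0)" for x y
    unfolding mprod_def M_def
    by (auto simp: case_prod_beta lookup_add intro!: differentiable_sum differentiable_mult differentiable_add)
  have one: "mprod ?S N (M 0) x y = (if x = y then 1 else 0)" if "x < c" "y < c" for x y
    using K[OF that] by (simp add: mprod_def M_def N_def sum.cartesian_product case_prod_beta)
  obtain H where "\<forall>\<^sub>F t in nhds 0. \<forall>x<c. \<forall>y<c.
        (\<Sum>l<c. mprod ?S N (M t) x l * H t l y) = (if x = y then 1 else 0) \<and>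
        (\<Sum>l<c. H t x l * mprod ?S N (M t) l y) = (if x = y then 1 else 0)"
    using inverse_of_curve_through_one[of c "\<lambda>t. mprod ?S N (M t)", OF diff one] by blast
  then show ?thesis
  proof (rule eventually_mono)
    fix t assume t: "\<forall>x<c. \<forall>y<c.
        (\<Sum>l<c. mprod ?S N (M t) x l * H t l y) = (if x = y then 1 else 0) \<and>
        (\<Sum>l<c. H t x l * mprod ?S N (M t) l y) = (if x = y then 1 else 0)"
    have "(\<Sum>i<a. \<Sum>j<b. mprod {..<c} (H t) N x (i, j) * entry (Z + t *\<^sub>R W) (i, j, y)) =
        (if x = y then 1 else 0)" if "x < c" "y < c" for x y
    proof -
      have "(\<Sum>i<a. \<Sum>j<b. mprod {..<c} (H t) N x (i, j) * entry (Z + t *\<^sub>R W) (i, j, y)) =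
          mprod ?S (mprod {..<c} (H t) N) (M t) x y"
        unfolding mprod_def[of ?S] by (simp add: M_def sum.cartesian_product case_prod_beta)
      also have "\<dots> = mprod {..<c} (H t) (mprod ?S N (M t)) x y" by (simp only: mprod_assoc)
      also have "\<dots> = (if x = y then 1 else 0)" unfolding mprod_def[of "{..<c}"] using t that by blast
      finally show ?thesis .
    qed
    then show "vec_space.rank (a * b) (left_unfolding a b c (Z + t *\<^sub>R W)) = c"
      unfolding left_unfolding_full_rank_iff by (intro exI[of _ "\<lambda>x i j. mprod {..<c} (H t) N x (i, j)"]) simp
  qed
qed

lemma eventually_right_unfolding_full_rank:
  fixes Z W :: core
  assumes "vec_space.rank a (right_unfolding a b c Z) = a"
  shows "\<forall>\<^sub>F t in nhds (0::real). vec_space.rank a (right_unfolding a b c (Z + t *\<^sub>R W)) = a"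
proof -
  let ?S = "{..<b} \<times> {..<c}"
  define M where "M t = (\<lambda>x (i, j). entry (Z + t *\<^sub>R W) (x, i, j))" for t
  obtain K where K: "\<And>x y. x < a \<Longrightarrow> y < a \<Longrightarrow>
      (\<Sum>i<b. \<Sum>j<c. entry Z (x, i, j) * K i j y) = (if x = y then 1 else 0)"
    using assms unfolding right_unfolding_full_rank_iff by blast
  define N where "N = (\<lambda>(i, j) y. K i j y)"
  have diff: "(\<lambda>t. mprod ?S (M t) N x y) differentiable (at 0)" for x y
    unfolding mprod_def M_def
    by (auto simp: case_prod_beta lookup_add intro!: differentiable_sum differentiable_mult differentiable_add)
  have one: "mprod ?S (M 0) N x y = (if x = y then 1 else 0)" if "x < a" "y < a" for x y
    using K[OF that] by (simp add: mprod_def M_def N_def sum.cartesian_product case_prod_beta)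
  obtain H where "\<forall>\<^sub>F t in nhds 0. \<forall>x<a. \<forall>y<a.
        (\<Sum>l<a. mprod ?S (M t) N x l * H t l y) = (if x = y then 1 else 0) \<and>
        (\<Sum>l<a. H t x l * mprod ?S (M t) N l y) = (if x = y then 1 else 0)"
    using inverse_of_curve_through_one[of a "\<lambda>t. mprod ?S (M t) N", OF diff one] by blast
  then show ?thesis
  proof (rule eventually_mono)
    fix t assume t: "\<forall>x<a. \<forall>y<a.
        (\<Sum>l<a. mprod ?S (M t) N x l * H t l y) = (if x = y then 1 else 0) \<and>
        (\<Sum>l<a. H t x l * mprod ?S (M t) N l y) = (if x = y then 1 else 0)"
    have "(\<Sum>i<b. \<Sum>j<c. entry (Z + t *\<^sub>R W) (x, i, j) * mprod {..<a} N (H t) (i, j) y) =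
        (if x = y then 1 else 0)" if "x < a" "y < a" for x y
    proof -
      have "(\<Sum>i<b. \<Sum>j<c. entry (Z + t *\<^sub>R W) (x, i, j) * mprod {..<a} N (H t) (i, j) y) =
          mprod ?S (M t) (mprod {..<a} N (H t)) x y"
        unfolding mprod_def[of ?S] by (simp add: M_def sum.cartesian_product case_prod_beta)
      also have "\<dots> = mprod {..<a} (mprod ?S (M t) N) (H t) x y" by (simp only: mprod_assoc)
      also have "\<dots> = (if x = y then 1 else 0)" unfolding mprod_def[of "{..<a}"] using t that by blast
      finally show ?thesis .
    qed
    then show "vec_space.rank a (right_unfolding a b c (Z + t *\<^sub>R W)) = a"
      unfolding right_unfolding_full_rank_iff by (intro exI[of _ "\<lambda>i j. mprod {..<a} N (H t) (i, j)"]) simp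
  qed
qed

lemma chain_line_polynomial: "\<exists>p. \<forall>t. chain r (X + t *\<^sub>R Z) k s a b = poly p t"
proof (induction s arbitrary: k a)
  case Nil
  then show ?case by (intro exI[of _ "[:if a = b then 1 else 0:]"]) simp
next
  case (Cons i s)
  have "\<forall>c. \<exists>p. \<forall>t. chain r (X + t *\<^sub>R Z) (Suc k) s c b = poly p t" using Cons.IH by blast
  then obtain p where p: "\<And>c t. chain r (X + t *\<^sub>R Z) (Suc k) s c b = poly (p c) t" by metis
  show ?case
    by (intro exI[of _ "\<Sum>c<r (Suc k). [:core_slice X (Suc k) i a c, core_slice Z (Suc k) i a c:] * p c"])
      (simp add: mprod_def p poly_sum core_slice_def lookup_add algebra_simps sum.distrib)
qed

context tt_format begin

lemma eventually_line_in_total_space: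
  assumes X: "X \<in> \<M>" and Z: "Z \<in> E"
  shows "\<forall>\<^sub>F t in nhds (0::real). X + t *\<^sub>R Z \<in> \<M>"
proof -
  have "\<forall>\<^sub>F t in nhds (0::real). \<forall>k\<in>{1..d}.
      vec_space.rank (r (k - 1) * n k) (left_unfolding (r (k - 1)) (n k) (r k) (entry X k + t *\<^sub>R entry Z k)) = r k \<and>
      vec_space.rank (r (k - 1)) (right_unfolding (r (k - 1)) (n k) (r k) (entry X k + t *\<^sub>R entry Z k)) = r (k - 1)"
    using X unfolding total_space_def
    by (intro eventually_ball_finite ballI eventually_conj eventually_left_unfolding_full_rank
        eventually_right_unfolding_full_rank) auto
  then show ?thesis
  proof (rule eventually_mono)
    fix t :: real
    assume *: "\<forall>k\<in>{1..d}.
      vec_space.rank (r (k - 1) * n k) (left_unfolding (r (k - 1)) (n k) (r k) (entry X k + t *\<^sub>R entry Z k)) = r k \<and>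
      vec_space.rank (r (k - 1)) (right_unfolding (r (k - 1)) (n k) (r k) (entry X k + t *\<^sub>R entry Z k)) = r (k - 1)"
    have "X \<in> E" using X by (simp add: total_space_def)
    then have "X + t *\<^sub>R Z \<in> E"
      using Z subspace_core_space by (intro real_vector.subspace_add real_vector.subspace_scale)
    then show "X + t *\<^sub>R Z \<in> \<M>" using * by (simp add: total_space_def lookup_add)
  qed
qed

lemma line_in_total_space:
  assumes X: "X \<in> \<M>" and Z: "Z \<in> E"
  obtains \<epsilon> :: real where "0 < \<epsilon>" "\<And>t. t \<in> {-\<epsilon><..<\<epsilon>} \<Longrightarrow> X + t *\<^sub>R Z \<in> \<M>"
proof -
  obtain \<epsilon> where \<epsilon>: "0 < \<epsilon>" "\<And>t. dist t (0::real) < \<epsilon> \<Longrightarrow> X + t *\<^sub>R Z \<in> \<M>"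
    using eventually_line_in_total_space[OF X Z] unfolding eventually_nhds_metric by blast
  have "X + t *\<^sub>R Z \<in> \<M>" if "t \<in> {-\<epsilon><..<\<epsilon>}" for t
    using that by (intro \<epsilon>(2)) (auto simp: dist_real_def)
  then show ?thesis by (rule that[OF \<epsilon>(1)])
qed

lemma line_has_vector_derivative: "((\<lambda>t. X + t *\<^sub>R Z) has_vector_derivative Z) (at (t::real))"
  by (auto intro!: derivative_eq_intros)

lemma smooth_line: "smooth_on_open (\<lambda>t. X + t *\<^sub>R Z) {-\<epsilon><..<\<epsilon>::real}"
proof -
  have eq: "(\<lambda>t. X + t *\<^sub>R Z) = (\<lambda>t. \<Sum>i\<in>{True, False}. poly (if i then 1 else [:0, 1:]) t *\<^sub>R (if i then X else Z))"
    by (simp add: fun_eq_iff)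
  show ?thesis unfolding smooth_on_open_def eq
    by (intro conjI allI open_greaterThanLessThan Ck_on_polynomial_curve)
qed

lemma smooth_phi_line: "smooth_on_open (\<lambda>t. \<phi> (X + t *\<^sub>R Z)) {-\<epsilon><..<\<epsilon>::real}"
proof -
  have "\<forall>is. \<exists>p. \<forall>t. C (X + t *\<^sub>R Z) 0 is 0 0 = poly p t" using chain_line_polynomial by blast
  then obtain p where p: "\<And>is t. C (X + t *\<^sub>R Z) 0 is 0 0 = poly (p is) t" by metis
  have eq: "(\<lambda>t. \<phi> (X + t *\<^sub>R Z)) =
      (\<lambda>t. \<Sum>is\<in>index_box n 0 d. poly (p is) t *\<^sub>R Poly_Mapping.single is 1)"
  proof
    fix t show "\<phi> (X + t *\<^sub>R Z) = (\<Sum>is\<in>index_box n 0 d. poly (p is) t *\<^sub>R Poly_Mapping.single is 1)"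
      using tensor_expansion[OF keys_tt_map, of "X + t *\<^sub>R Z"] by (simp add: entry_tt_map p)
  qed
  show ?thesis unfolding smooth_on_open_def eq
    by (intro conjI allI open_greaterThanLessThan Ck_on_polynomial_curve)
qed

lemma core_space_tangent:
  assumes "X \<in> E" "Z \<in> E"
  shows "Z \<in> tangent_space E X"
proof -
  have "(\<lambda>t. X + t *\<^sub>R Z) ` {-1<..<1::real} \<subseteq> E"
    using assms subspace_core_space by (auto intro: real_vector.subspace_add real_vector.subspace_scale)
  then show ?thesis
    unfolding tangent_space_def
    using smooth_line[of X Z 1] line_has_vector_derivative[of X Z 0]
    by (intro CollectI exI[of _ 1] conjI exI[of _ "\<lambda>t. X + t *\<^sub>R Z"]) auto
qed

lemma total_space_tangent:
  assumes X: "X \<in> \<M>" and Z: "Z \<in> E"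
  shows "Z \<in> tangent_space \<M> X"
proof -
  obtain \<epsilon> where \<epsilon>: "0 < \<epsilon>" "\<And>t. t \<in> {-\<epsilon><..<\<epsilon>} \<Longrightarrow> X + t *\<^sub>R Z \<in> \<M>"
    by (rule line_in_total_space[OF X Z]) (rule that)
  then show ?thesis
    unfolding tangent_space_def
    using smooth_line[of X Z \<epsilon>] line_has_vector_derivative[of X Z 0]
    by (intro CollectI exI[of _ \<epsilon>] conjI exI[of _ "\<lambda>t. X + t *\<^sub>R Z"]) auto
qed

abbreviation "\<N> \<equiv> tt_manifold d n r"

text \<open>The curve \<open>\<phi>(X + t Z)\<close> lies in the manifold for small \<open>t\<close> and has velocity \<open>D\<phi>[Z]\<close>.\<close>

lemma dphi_tangent:
  assumes X: "X \<in> \<M>" and Z: "Z \<in> E"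
  shows "d\<phi> X Z \<in> tangent_space \<N> (\<phi> X)"
proof -
  obtain \<epsilon> where \<epsilon>: "0 < \<epsilon>" "\<And>t. t \<in> {-\<epsilon><..<\<epsilon>} \<Longrightarrow> X + t *\<^sub>R Z \<in> \<M>"
    by (rule line_in_total_space[OF X Z]) (rule that)
  have "((\<phi> \<circ> (\<lambda>t. X + t *\<^sub>R Z)) has_vector_derivative d\<phi> X Z) (at 0)"
    using has_derivative_phi[of X] \<epsilon>(1) line_has_vector_derivative[of X Z 0]
    by (intro has_derivative_along_curve[of \<phi> _ X UNIV \<epsilon>]) auto
  then show ?thesis
    unfolding tangent_space_def
    using smooth_phi_line[of X Z \<epsilon>] \<epsilon>
    by (intro CollectI exI[of _ \<epsilon>] conjI exI[of _ "\<lambda>t. \<phi> (X + t *\<^sub>R Z)"])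
      (auto simp: o_def tt_manifold_def)
qed

section \<open>The tangent space of the TT manifold\<close>

text \<open>
  Inserting \<open>T\<^sub>k Q\<^sub>k = 1\<close> at the inner cuts does not change the product of the slices. At the outer cuts
  nothing is inserted, so there \<open>Q\<close> has to be trivial.
\<close>

lemma phi_gauge_invariant:
  assumes TQ: "\<And>k. k \<le> d \<Longrightarrow> is_one (r k) (mprod {..<r k} (T k) (Q k))"
    and Q0: "is_one (r 0) (Q 0)" and Qd: "is_one (r d) (Q d)"
    and core_slice: "\<And>k i x y. k < d \<Longrightarrow> i < n (Suc k) \<Longrightarrow> x < r k \<Longrightarrow> y < r (Suc k) \<Longrightarrow>
      core_slice Y' (Suc k) i x y = mprod {..<r k} (Q k) (mprod {..<r (Suc k)} (core_slice Y (Suc k) i) (T (Suc k))) x y"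
  shows "\<phi> Y' = \<phi> Y"
proof -
  have right_part: "right_part Y' k x s = mprod {..<r k} (Q k) (right_part Y k) x s"
    if "k \<le> d" "s \<in> index_box n k (d - k)" "x < r k" for k x s
    using that
  proof (induction k arbitrary: x s rule: inc_induct)
    case base
    then have "right_part Y' d x s = right_part Y d x s" by (simp add: right_part_def)
    then show ?case unfolding mprod_one_left[OF Qd base(2)] .
  next
    case (step k)
    have "d - k = Suc (d - Suc k)" using step by simp
    then obtain i s' where s: "s = i # s'" "i < n (Suc k)" "s' \<in> index_box n (Suc k) (d - Suc k)"
      using step.prems by (auto simp: index_box_Suc)
    let ?N = "{..<r (Suc k)}" and ?S = "core_slice Y (Suc k) i"
    have "right_part Y' k x s = mprod ?N (core_slice Y' (Suc k) i) (right_part Y' (Suc k)) x s'"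
      by (simp add: s right_part_Cons)
    also have "\<dots> = mprod ?N (mprod {..<r k} (Q k) (mprod ?N ?S (T (Suc k))))
        (mprod ?N (Q (Suc k)) (right_part Y (Suc k))) x s'"
      using step s by (intro mprod_cong core_slice step.IH) auto
    also have "\<dots> = mprod {..<r k} (Q k) (mprod ?N ?S (mprod ?N (mprod ?N (T (Suc k)) (Q (Suc k))) (right_part Y (Suc k)))) x s'"
      by (simp only: mprod_assoc)
    also have "\<dots> = mprod {..<r k} (Q k) (mprod ?N ?S (right_part Y (Suc k))) x s'"
      using step by (intro mprod_cong refl mprod_one_left[OF TQ]) auto
    also have "\<dots> = mprod {..<r k} (Q k) (right_part Y k) x s"
      by (simp add: mprod_def[of "{..<r k}"] s right_part_Cons)
    finally show ?case .
  qed
  show ?thesis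
  proof (rule poly_mapping_eqI)
    fix "is"
    have "C Y' 0 is 0 0 = C Y 0 is 0 0" if "is \<in> index_box n 0 d"
      using right_part[of 0 "is" 0] that r_0 mprod_one_left[OF Q0, of 0] by (simp add: right_part_def)
    then show "entry (\<phi> Y') is = entry (\<phi> Y) is" by (simp add: entry_tt_map)
  qed
qed

text \<open>
  What the contractions that define the lift give on a tensor \<open>\<phi>(Y)\<close>: products of the cores of \<open>Y\<close>
  with the same square matrices \<open>L\<^sub>k Y\<^sub>\<le>\<^sub>k\<close> and \<open>Y\<^sub>>\<^sub>k R\<^sub>k\<close> at every cut.
\<close>

lemma contract_split:
  assumes "k \<le> d"
  shows "mprod (index_box n 0 k) L (mprod (index_box n k (d - k)) (\<lambda>p s. entry (\<phi> Y) (p @ s)) R) x y =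
    mprod {..<r k} (mprod (index_box n 0 k) L (left_part Y)) (mprod (index_box n k (d - k)) (right_part Y k) R) x y"
proof -
  have e: "entry (\<phi> Y) (p @ s) = mprod {..<r k} (left_part Y) (right_part Y k) p s"
    if "p \<in> index_box n 0 k" "s \<in> index_box n k (d - k)" for p s
  proof -
    have len: "length p = k" using that by (simp add: index_box_def)
    have mem: "p @ s \<in> index_box n 0 d" using that index_box_append[of p n 0 k s "d - k"] assms by simp
    show ?thesis using mem by (simp add: entry_tt_map chain_split[OF len])
  qed
  have "mprod (index_box n 0 k) L (mprod (index_box n k (d - k)) (\<lambda>p s. entry (\<phi> Y) (p @ s)) R) x y =
      mprod (index_box n 0 k) L (mprod (index_box n k (d - k)) (mprod {..<r k} (left_part Y) (right_part Y k)) R) x y"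
    by (intro mprod_cong refl e)
  then show ?thesis by (simp only: mprod_assoc)
qed

lemma contract_middle:
  assumes k: "k < d" and i: "i < n (Suc k)"
  shows "mprod (index_box n 0 k) L (mprod (index_box n (Suc k) (d - Suc k)) (\<lambda>p s. entry (\<phi> Y) (p @ i # s)) R) x y =
    mprod {..<r k} (mprod (index_box n 0 k) L (left_part Y))
      (mprod {..<r (Suc k)} (core_slice Y (Suc k) i) (mprod (index_box n (Suc k) (d - Suc k)) (right_part Y (Suc k)) R)) x y"
proof -
  let ?M = "mprod {..<r k} (left_part Y) (mprod {..<r (Suc k)} (core_slice Y (Suc k) i) (right_part Y (Suc k)))"
  have e: "entry (\<phi> Y) (p @ i # s) = ?M p s"
    if "p \<in> index_box n 0 k" "s \<in> index_box n (Suc k) (d - Suc k)" for p s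
  proof -
    have len: "length p = k" using that by (simp add: index_box_def)
    show ?thesis using index_box_middle[OF that(1) i that(2) k]
      by (simp add: entry_tt_map chain_split[OF len]) (simp add: mprod_def[of "{..<r k}"] right_part_Cons)
  qed
  have "mprod (index_box n 0 k) L (mprod (index_box n (Suc k) (d - Suc k)) (\<lambda>p s. entry (\<phi> Y) (p @ i # s)) R) x y =
      mprod (index_box n 0 k) L (mprod (index_box n (Suc k) (d - Suc k)) ?M R) x y"
    by (intro mprod_cong refl e)
  then show ?thesis by (simp only: mprod_sandwich)
qed

lemma core_curve_derivative:
  assumes E: "\<And>t. c t \<in> E" and diff: "\<And>k q. (\<lambda>t. entry (entry (c t) k) q) differentiable (at (0::real))"
  obtains W where "W \<in> E" "(c has_vector_derivative W) (at 0)"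
proof -
  obtain J b where J: "finite J" "b ` J \<subseteq> E"
    "\<And>X. X \<in> E \<Longrightarrow> X = (\<Sum>j\<in>J. entry (entry X (fst j)) (snd j) *\<^sub>R b j)"
    by (rule core_space_basis) (rule that)
  define e where "e j = vector_derivative (\<lambda>t. entry (entry (c t) (fst j)) (snd j)) (at 0)" for j
  have e: "((\<lambda>t. entry (entry (c t) (fst j)) (snd j)) has_vector_derivative e j) (at 0)" for j
    unfolding e_def using diff by (simp add: vector_derivative_works[symmetric])
  have "((\<lambda>t. \<Sum>j\<in>J. entry (entry (c t) (fst j)) (snd j) *\<^sub>R b j) has_vector_derivative (\<Sum>j\<in>J. e j *\<^sub>R b j)) (at 0)"
    using e by (intro has_vector_derivative_sum bounded_linear.has_vector_derivative[OF bounded_linear_scaleR_left])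
  moreover have "(\<lambda>t. \<Sum>j\<in>J. entry (entry (c t) (fst j)) (snd j) *\<^sub>R b j) = c"
    by (rule ext) (rule J(3)[OF E, symmetric])
  moreover have "(\<Sum>j\<in>J. e j *\<^sub>R b j) \<in> E"
    using J(2) subspace_core_space
    by (intro real_vector.subspace_sum real_vector.subspace_scale) auto
  ultimately show ?thesis using that by simp
qed

text \<open>
  The lift \<open>\<psi>(t)\<close> has the cores \<open>G\<^sub>k(t)\<inverse> P\<^sub>k(t)\<close>, or \<open>P\<^sub>0(t)\<close> for \<open>k = 0\<close>, where \<open>G\<^sub>k = L\<^sub>k A R\<^sub>k\<close> and
  \<open>P\<^sub>k = L\<^sub>k A R\<^sub>k\<^sub>+\<^sub>1\<close> are contractions of \<open>A(t)\<close> with inverses that do not move. It is differentiable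
  because \<open>A(t)\<close> enters linearly, apart from the matrix inverse. If \<open>A(t) = \<phi>(Y)\<close>, then with
  \<open>S\<^sub>k = L\<^sub>k Y\<^sub>\<le>\<^sub>k\<close> and \<open>T\<^sub>k = Y\<^sub>>\<^sub>k R\<^sub>k\<close> one has \<open>G\<^sub>k = S\<^sub>k T\<^sub>k\<close> and \<open>P\<^sub>k = S\<^sub>k Y\<^sup>k\<^sup>+\<^sup>1 T\<^sub>k\<^sub>+\<^sub>1\<close>, so \<open>\<psi>(t)\<close> is a
  gauge transform of \<open>Y\<close> and \<open>\<phi>(\<psi>(t)) = A(t)\<close>. Here \<open>Y\<close> is chosen for each \<open>t\<close> separately. Differentiating
  at \<open>0\<close> shows that the velocity of \<open>A\<close> is \<open>D\<phi>[\<psi>'(0)]\<close>.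
\<close>

lemma velocity_in_range_dphi:
  fixes A :: "real \<Rightarrow> tensor"
  assumes X: "X \<in> \<M>" and A0: "A 0 = \<phi> X"
    and A: "\<forall>\<^sub>F t in nhds 0. A t \<in> \<phi> ` E"
    and dA: "(A has_vector_derivative v) (at 0)"
  shows "\<exists>W\<in>E. v = d\<phi> X W"
proof -
  have XE: "X \<in> E" using X by (simp add: total_space_def)
  obtain L where L: "\<And>k. k \<le> d \<Longrightarrow> is_one (r k) (mprod (index_box n 0 k) (L k) (left_part X))"
    using left_interface_inverse[OF X] by metis
  obtain R where R: "\<And>k. k \<le> d \<Longrightarrow> is_one (r k) (mprod (index_box n k (d - k)) (right_part X k) (R k))"
    using right_interface_inverse[OF X] by metis
  have dentry: "(\<lambda>t. entry (A t) is) differentiable (at 0)" for "is"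
    using has_vector_derivative_entry[OF dA] by (rule differentiableI_vector)
  define G where "G k t = mprod (index_box n 0 k) (L k)
     (mprod (index_box n k (d - k)) (\<lambda>p s. entry (A t) (p @ s)) (R k))" for k t
  define P where "P k i t = mprod (index_box n 0 k) (L k)
     (mprod (index_box n (Suc k) (d - Suc k)) (\<lambda>p s. entry (A t) (p @ i # s)) (R (Suc k)))" for k i t
  have dG: "(\<lambda>t. G k t x y) differentiable (at 0)" for k x y
    unfolding G_def mprod_def
    by (intro differentiable_sum differentiable_mult ballI finite_index_box differentiable_const dentry)
  have dP: "(\<lambda>t. P k i t x y) differentiable (at 0)" for k i x y
    unfolding P_def mprod_def
    by (intro differentiable_sum differentiable_mult ballI finite_index_box differentiable_const dentry)
  define S where "S Y k = mprod (index_box n 0 k) (L k) (left_part Y)" for Y k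
  define T where "T Y k = mprod (index_box n k (d - k)) (right_part Y k) (R k)" for Y k
  have G_eq: "G k t x y = mprod {..<r k} (S Y k) (T Y k) x y" if "A t = \<phi> Y" "k \<le> d" for k t x y Y
    unfolding G_def S_def T_def that(1) by (rule contract_split[OF that(2)])
  have P_eq: "P k i t x y = mprod {..<r k} (S Y k) (mprod {..<r (Suc k)} (core_slice Y (Suc k) i) (T Y (Suc k))) x y"
    if "A t = \<phi> Y" "k < d" "i < n (Suc k)" for k i t x y Y
    unfolding P_def S_def T_def that(1) by (rule contract_middle[OF that(2,3)])
  have SX: "is_one (r k) (S X k)" and TX: "is_one (r k) (T X k)" if "k \<le> d" for k
    using L R that by (auto simp: S_def T_def)
  have G0: "G k 0 x y = (if x = y then 1 else 0)" if "k \<le> d" "x < r k" "y < r k" for k x y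
    using mprod_is_one[OF SX TX, OF that(1) that(1)] that(2,3)
    unfolding G_eq[of 0 X, OF A0 that(1)] is_one_def by blast
  define inverse_near where "inverse_near k H \<longleftrightarrow>
      (\<forall>x<r k. \<forall>y<r k. (\<lambda>t. H t x y) differentiable (at 0)) \<and>
      (\<forall>\<^sub>F t in nhds 0. \<forall>x<r k. \<forall>y<r k.
        (\<Sum>l<r k. G k t x l * H t l y) = (if x = y then 1 else 0) \<and>
        (\<Sum>l<r k. H t x l * G k t l y) = (if x = y then 1 else 0))"
    for k and H :: "real \<Rightarrow> nat \<Rightarrow> nat \<Rightarrow> real"
  have "\<exists>H. inverse_near k H" if "k \<le> d" for k
    unfolding inverse_near_def by (rule inverse_of_curve_through_one[OF dG G0[OF that]])
  then obtain H where "\<And>k. k \<le> d \<Longrightarrow> inverse_near k (H k)" by metis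
  then have
    dH: "\<And>k x y. k \<le> d \<Longrightarrow> x < r k \<Longrightarrow> y < r k \<Longrightarrow> (\<lambda>t. H k t x y) differentiable (at 0)" and
    H: "\<And>k. k \<le> d \<Longrightarrow> \<forall>\<^sub>F t in nhds 0. \<forall>x<r k. \<forall>y<r k.
        (\<Sum>l<r k. G k t x l * H k t l y) = (if x = y then 1 else 0) \<and>
        (\<Sum>l<r k. H k t x l * G k t l y) = (if x = y then 1 else 0)"
    unfolding inverse_near_def by blast+
  have H': "\<forall>\<^sub>F t in nhds 0. is_one (r k) (mprod {..<r k} (H k t) (G k t))" if "k \<le> d" for k
    using H[OF that] by (rule eventually_mono) (simp add: is_one_def mprod_def)
  \<comment> \<open>The normalisation by \<open>G\<^sub>k\<inverse>\<close> is left out at the outer cut \<open>0\<close>: there \<open>G\<^sub>0(t)\<close> is the number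
    \<open>A(t) R\<^sub>0\<close>, and dividing by it would rescale the tensor.\<close>
  define U where "U k t = (if k = 0 then (\<lambda>x y. if x = y then 1 else 0) else H k t)" for k t
  have dU: "(\<lambda>t. U k t x y) differentiable (at 0)" if "k \<le> d" "x < r k" "y < r k" for k x y
    using dH[OF that] by (cases "k = 0") (simp_all add: U_def)
  define V where "V k = {..<r (k - 1)} \<times> {..<n k} \<times> {..<r k}" for k
  define f where "f k t = (\<lambda>(x, i, y). mprod {..<r (k - 1)} (U (k - 1) t) (P (k - 1) i t) x y)" for k t
  define \<psi> where "\<psi> t = on_support {1..d} (\<lambda>k. on_support (V k) (f k t))" for t
  have finV: "finite (V k)" for k by (simp add: V_def)
  have entry_\<psi>: "entry (entry (\<psi> t) k) q = (if k \<in> {1..d} \<and> q \<in> V k then f k t q else 0)" for t k q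
    by (simp add: \<psi>_def entry_on_support finV)
  have \<psi>E: "\<psi> t \<in> E" for t
    by (intro core_spaceI) (auto simp: entry_\<psi> V_def split: if_splits)
  have sl_\<psi>: "core_slice (\<psi> t) (Suc k) i x y = mprod {..<r k} (U k t) (P k i t) x y"
    if "k < d" "x < r k" "i < n (Suc k)" "y < r (Suc k)" for t k i x y
    using that by (simp add: core_slice_def entry_\<psi> V_def f_def)
  have d\<psi>: "(\<lambda>t. entry (entry (\<psi> t) k) q) differentiable (at 0)" for k q
  proof (cases "k \<in> {1..d} \<and> q \<in> V k")
    case True
    obtain x i y where q: "q = (x, i, y)" by (cases q)
    have "(\<lambda>t. \<Sum>c<r (k - 1). U (k - 1) t x c * P (k - 1) i t c y) differentiable (at 0)"
      using True q by (intro differentiable_sum differentiable_mult ballI dP dU finite_lessThan) (auto simp: V_def)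
    then show ?thesis using True by (simp add: entry_\<psi> f_def q mprod_def)
  qed (simp only: entry_\<psi> if_False differentiable_const)
  obtain W where W: "W \<in> E" "(\<psi> has_vector_derivative W) (at 0)"
    by (rule core_curve_derivative[OF \<psi>E d\<psi>]) (rule that)
  have U0: "is_one (r k) (U k 0)" if "k \<le> d" for k
  proof (cases "k = 0")
    case False
    have HG: "is_one (r k) (mprod {..<r k} (H k 0) (G k 0))" using eventually_nhds_x_imp_x[OF H'[OF that]] .
    have "is_one (r k) (G k 0)" using G0[OF that] by (simp add: is_one_def)
    then have "mprod {..<r k} (H k 0) (G k 0) x y = H k 0 x y" if "y < r k" for x y
      using that by (rule mprod_one_right)
    then show ?thesis using HG False by (simp add: is_one_def U_def)
  qed (simp add: is_one_def U_def)
  have \<psi>0: "\<psi> 0 = X"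
  proof (rule core_space_eqI[OF \<psi>E XE])
    fix k x i y assume k: "k < d" and xiy: "x < r k" "i < n (Suc k)" "y < r (Suc k)"
    have "core_slice (\<psi> 0) (Suc k) i x y = P k i 0 x y"
      unfolding sl_\<psi>[OF k xiy] using k xiy by (intro mprod_one_left[OF U0]) auto
    also have "\<dots> = mprod {..<r (Suc k)} (core_slice X (Suc k) i) (T X (Suc k)) x y"
      unfolding P_eq[of 0 X, OF A0 k xiy(2)] using k xiy by (intro mprod_one_left[OF SX]) auto
    also have "\<dots> = core_slice X (Suc k) i x y"
      using k xiy by (intro mprod_one_right[OF TX]) auto
    finally show "core_slice (\<psi> 0) (Suc k) i x y = core_slice X (Suc k) i x y" .
  qed
  have "\<forall>\<^sub>F t in nhds 0. \<forall>k\<in>{..d}. is_one (r k) (mprod {..<r k} (H k t) (G k t))"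
    by (intro eventually_ball_finite ballI H') auto
  with A have lift: "\<forall>\<^sub>F t in nhds 0. \<phi> (\<psi> t) = A t"
  proof eventually_elim
    case (elim t)
    then obtain Y where Y: "Y \<in> E" "A t = \<phi> Y" by auto
    have HG: "is_one (r k) (mprod {..<r k} (H k t) (G k t))" if "k \<le> d" for k using elim that by simp
    define Q' where "Q' k = (if k = 0 then (\<lambda>x y. if x = y then 1 else 0) else mprod {..<r k} (H k t) (S Y k))" for k
    define T' where "T' k = (if k = 0 then (\<lambda>x y. if x = y then 1 else 0) else T Y k)" for k
    have QT: "is_one (r k) (mprod {..<r k} (Q' k) (T' k))" if "k \<le> d" for k
    proof (cases "k = 0")
      case True
      then show ?thesis by (intro mprod_is_one) (simp_all add: Q'_def T'_def is_one_def)
    next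
      case False
      have "mprod {..<r k} (Q' k) (T' k) x y = mprod {..<r k} (H k t) (G k t) x y" for x y
        using False by (simp add: Q'_def T'_def mprod_assoc) (intro mprod_cong refl G_eq[OF Y(2) that, symmetric])
      then show ?thesis using HG[OF that] by (simp add: is_one_def)
    qed
    \<comment> \<open>At the cut \<open>d\<close> the right interface matrix is the empty product for every \<open>Y\<close>, so \<open>T\<^sub>d = 1\<close>
      because this holds for \<open>X\<close>; likewise \<open>S\<^sub>0 = 1\<close> at the cut \<open>0\<close>.\<close>
    have Td: "is_one (r d) (T' d)"
      using TX[of d] d_pos by (simp add: T'_def is_one_def T_def mprod_def right_part_def)
    have Qd: "is_one (r d) (Q' d)"
      unfolding is_one_def
    proof (intro allI impI)
      fix x y assume xy: "x < r d" "y < r d"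
      have "mprod {..<r d} (Q' d) (T' d) x y = (if x = y then 1 else 0)"
        using QT[of d] xy unfolding is_one_def by blast
      then show "Q' d x y = (if x = y then 1 else 0)" unfolding mprod_one_right[OF Td xy(2)] .
    qed
    have S0: "is_one (r 0) (S Y 0)"
      using SX[of 0] by (simp add: is_one_def S_def mprod_def left_part_def)
    show ?case unfolding Y(2)
    proof (rule phi_gauge_invariant[of T' Q'])
      show "is_one (r k) (mprod {..<r k} (T' k) (Q' k))" if "k \<le> d" for k
        using QT[OF that] by (rule is_one_swap)
      show "is_one (r 0) (Q' 0)" by (simp add: Q'_def is_one_def)
      show "is_one (r d) (Q' d)" by (rule Qd)
    next
      fix k i x y assume k: "k < d" and xiy: "i < n (Suc k)" "x < r k" "y < r (Suc k)"
      let ?B = "mprod {..<r (Suc k)} (core_slice Y (Suc k) i) (T Y (Suc k))"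
      have "core_slice (\<psi> t) (Suc k) i x y = mprod {..<r k} (U k t) (P k i t) x y"
        by (rule sl_\<psi>[OF k xiy(2,1,3)])
      also have "\<dots> = mprod {..<r k} (U k t) (mprod {..<r k} (S Y k) ?B) x y"
        by (intro mprod_cong refl P_eq[OF Y(2) k xiy(1)])
      also have "\<dots> = mprod {..<r k} (Q' k) ?B x y"
      proof (cases "k = 0")
        case True
        then show ?thesis using xiy(2)
          by (simp add: U_def Q'_def mprod_id_left mprod_one_left[OF S0])
      next
        case False
        then show ?thesis by (simp add: U_def Q'_def mprod_assoc)
      qed
      finally show "core_slice (\<psi> t) (Suc k) i x y =
          mprod {..<r k} (Q' k) (mprod {..<r (Suc k)} (core_slice Y (Suc k) i) (T' (Suc k))) x y"
        by (simp add: T'_def)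
    qed
  qed
  have "((\<phi> \<circ> \<psi>) has_vector_derivative d\<phi> X W) (at 0)"
    using has_derivative_phi[of X] W(2) \<psi>0
    by (intro has_derivative_along_curve[of \<phi> _ X UNIV 1]) auto
  moreover have "((\<phi> \<circ> \<psi>) has_vector_derivative d\<phi> X W) (at 0) =
      (A has_vector_derivative d\<phi> X W) (at 0)"
    by (rule has_vector_derivative_cong_ev)
      (use lift in \<open>auto simp: \<psi>0 A0 elim!: eventually_mono\<close>)
  ultimately have "(A has_vector_derivative d\<phi> X W) (at 0)" by blast
  then have "v = d\<phi> X W" using dA by (intro vector_derivative_unique_at)
  then show ?thesis using W(1) by blast
qed

lemma tangent_space_tt_manifold:
  assumes X: "X \<in> \<M>"
  shows "tangent_space \<N> (\<phi> X) = d\<phi> X ` E"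
proof
  show "d\<phi> X ` E \<subseteq> tangent_space \<N> (\<phi> X)" using dphi_tangent[OF X] by blast
  show "tangent_space \<N> (\<phi> X) \<subseteq> d\<phi> X ` E"
  proof
    fix v assume "v \<in> tangent_space \<N> (\<phi> X)"
    then obtain \<epsilon> c where c: "0 < \<epsilon>" "c ` {-\<epsilon><..<\<epsilon>} \<subseteq> \<N>" "c 0 = \<phi> X"
      "(c has_vector_derivative v) (at (0::real))"
      unfolding tangent_space_def by blast
    have "\<forall>\<^sub>F t in nhds 0. t \<in> {-\<epsilon><..<\<epsilon>}"
      using c(1) by (intro eventually_nhds_in_open) auto
    moreover have "\<N> \<subseteq> \<phi> ` E"
      unfolding tt_manifold_def total_space_def by (intro image_mono) blast
    ultimately have "\<forall>\<^sub>F t in nhds 0. c t \<in> \<phi> ` E"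
      using c(2) by (elim eventually_mono) blast
    then show "v \<in> d\<phi> X ` E" using velocity_in_range_dphi[OF X c(3) _ c(4)] by blast
  qed
qed

end

section \<open>Equality of the two Gauss--Newton steps\<close>

theorem theorem3p3:
  fixes d :: nat and n r :: "nat \<Rightarrow> nat"
    and Xbar \<xi>bar :: cores and X \<xi> :: tensor
    and F :: "tensor \<Rightarrow> 'w::euclidean_space" and Fbar :: "cores \<Rightarrow> 'w"
  assumes "d \<ge> 2"
    and "\<forall>k\<in>{1..d}. n k \<ge> 1"
    and "r 0 = 1" and "r d = 1"
    and "\<forall>k\<in>{0..d}. r k \<ge> 1"
    and "\<forall>k\<in>{1..d}. r (k - 1) \<le> n k * r k \<and> r k \<le> n k * r (k - 1)"
    and "Xbar \<in> total_space d n r"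
    and "X = tt_map d n r Xbar"
    and "smooth_on_submanifold F (tt_manifold d n r)"
    and "Fbar = F \<circ> tt_map d n r"
    and quotient_gauss_newton:
      "{\<zeta> \<in> horizontal_space d n r Xbar. \<forall>\<eta> \<in> horizontal_space d n r Xbar.
          inner (differential (total_space d n r) Fbar Xbar \<eta>) (Fbar Xbar) +
          inner (differential (total_space d n r) Fbar Xbar \<eta>)
                (differential (total_space d n r) Fbar Xbar \<zeta>) = 0} = {\<xi>bar}"
    and embedded_gauss_newton:
      "{\<zeta> \<in> tangent_space (tt_manifold d n r) X. \<forall>\<eta> \<in> tangent_space (tt_manifold d n r) X.
          inner (differential (tt_manifold d n r) F X \<eta>) (F X) +
          inner (differential (tt_manifold d n r) F X \<eta>)
                (differential (tt_manifold d n r) F X \<zeta>) = 0} = {\<xi>}"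
  shows "differential (core_space d n r) (tt_map d n r) Xbar \<xi>bar = \<xi> \<and>
    embedded_retraction d n r Xbar \<xi> = tt_map d n r (quotient_retraction Xbar \<xi>bar)"
proof -
  interpret tt_format d n r using assms(1,3,4) by unfold_locales auto
  note Xb = \<open>Xbar \<in> \<M>\<close> and X_eq = \<open>X = \<phi> Xbar\<close> and Fbar_eq = \<open>Fbar = F \<circ> \<phi>\<close>
  have XbE: "Xbar \<in> E" using Xb by (simp add: total_space_def)
  have HE: "\<H> Xbar \<subseteq> E" by (auto simp: horizontal_space_def)
  have XN: "X \<in> \<N>" using Xb X_eq by (simp add: tt_manifold_def)
  have D\<phi>: "differential E \<phi> Xbar \<eta> = d\<phi> Xbar \<eta>" if "\<eta> \<in> E" for \<eta>
    by (rule differential_tangent[OF has_derivative_at_withinI[OF has_derivative_phi] core_space_tangent[OF XbE that]])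
  have DF: "(F has_derivative differential \<N> F X) (at X within \<N>)"
    by (rule smooth_on_submanifold_has_derivative[OF assms(9) XN])
  have dFbar: "(Fbar has_derivative differential \<N> F X \<circ> d\<phi> Xbar) (at Xbar within \<M>)"
    unfolding Fbar_eq
    by (rule diff_chain_within[OF has_derivative_at_withinI[OF has_derivative_phi]])
      (use DF in \<open>simp add: X_eq tt_manifold_def\<close>)
  have DFbar: "differential \<M> Fbar Xbar \<eta> = differential \<N> F X (d\<phi> Xbar \<eta>)" if "\<eta> \<in> E" for \<eta>
    using differential_tangent[OF dFbar total_space_tangent[OF Xb that]] by simp
  have T: "tangent_space \<N> X = d\<phi> Xbar ` \<H> Xbar"
  proof -
    have "d\<phi> Xbar ` E \<subseteq> d\<phi> Xbar ` \<H> Xbar" 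
    proof
      fix v assume "v \<in> d\<phi> Xbar ` E"
      then obtain Z where "Z \<in> E" "v = d\<phi> Xbar Z" by blast
      moreover obtain W where "W \<in> \<H> Xbar" "d\<phi> Xbar W = d\<phi> Xbar Z"
        using horizontal_lift[OF Xb \<open>Z \<in> E\<close>] by blast
      ultimately show "v \<in> d\<phi> Xbar ` \<H> Xbar" by (intro image_eqI[of _ _ W]) simp_all
    qed
    then show ?thesis unfolding X_eq tangent_space_tt_manifold[OF Xb] using HE by blast
  qed
  have \<xi>bar: "\<xi>bar \<in> \<H> Xbar"
    "\<And>\<eta>. \<eta> \<in> \<H> Xbar \<Longrightarrow> inner (differential \<M> Fbar Xbar \<eta>) (Fbar Xbar) +
          inner (differential \<M> Fbar Xbar \<eta>) (differential \<M> Fbar Xbar \<xi>bar) = 0"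
    using quotient_gauss_newton by blast+
  have "d\<phi> Xbar \<xi>bar \<in> {\<zeta> \<in> tangent_space \<N> X. \<forall>\<eta> \<in> tangent_space \<N> X.
          inner (differential \<N> F X \<eta>) (F X) + inner (differential \<N> F X \<eta>) (differential \<N> F X \<zeta>) = 0}"
  proof (intro CollectI conjI ballI)
    show "d\<phi> Xbar \<xi>bar \<in> tangent_space \<N> X" using \<xi>bar(1) T by blast
    fix \<eta> assume "\<eta> \<in> tangent_space \<N> X"
    then obtain \<zeta> where \<zeta>: "\<zeta> \<in> \<H> Xbar" "\<eta> = d\<phi> Xbar \<zeta>" using T by blast
    have in_E: "\<zeta> \<in> E" "\<xi>bar \<in> E" using \<zeta>(1) \<xi>bar(1) HE by auto
    have "Fbar Xbar = F X" by (simp add: Fbar_eq X_eq)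
    then show "inner (differential \<N> F X \<eta>) (F X) +
        inner (differential \<N> F X \<eta>) (differential \<N> F X (d\<phi> Xbar \<xi>bar)) = 0"
      using \<xi>bar(2)[OF \<zeta>(1)] unfolding DFbar[OF in_E(1)] DFbar[OF in_E(2)] \<zeta>(2) by simp
  qed
  then have d\<xi>: "d\<phi> Xbar \<xi>bar = \<xi>" using embedded_gauss_newton by blast
  have sum: "Xbar + \<xi>bar \<in> \<H> Xbar"
    using self_horizontal[OF Xb] \<xi>bar(1) subspace_horizontal by (intro real_vector.subspace_add)
  have inj: "inj_on (differential E \<phi> Xbar) (\<H> Xbar)"
    using dphi_inj_on_horizontal[OF Xb] HE D\<phi> by (auto simp: inj_on_def subset_iff)
  have "differential E \<phi> Xbar (Xbar + \<xi>bar) = real d *\<^sub>R X + \<xi>"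
    using sum HE by (simp add: D\<phi> subset_iff linear_add[OF linear_dphi] dphi_self d\<xi> X_eq)
  then have "the_inv_into (\<H> Xbar) (differential E \<phi> Xbar) (real d *\<^sub>R X + \<xi>) = Xbar + \<xi>bar"
    using the_inv_into_f_f[OF inj sum] by simp
  then have "embedded_retraction d n r Xbar \<xi> = \<phi> (quotient_retraction Xbar \<xi>bar)"
    by (simp add: embedded_retraction_def quotient_retraction_def X_eq)
  moreover have "differential E \<phi> Xbar \<xi>bar = \<xi>" using D\<phi> \<xi>bar(1) HE d\<xi> by auto
  ultimately show ?thesis by blast
qed

end
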